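(* Let $d\geq 2$, let $\mathbb{T}^d=\mathbb{R}^d/\mathbb{Z}^d$, and fix $\alpha>0$. Let $a\in\mathcal{C}^\infty(\mathbb{T}^d)$ be independent of $\hbar$. Then there exists a constant $C_a>0$ such that, for every $0<\hbar\leq 1$ with $N(\hbar)\geq 1$ and for every orthonormal basis $(\psi_\hbar^j)_{j=1,\ldots,N(\hbar)}$ of $\mathcal{H}_\hbar=\mathbf{1}_{[1-\alpha\hbar,1+\alpha\hbar]}(-\hbar^2\Delta)L^2(\mathbb{T}^d)$ made of eigenfunctions of $-\hbar^2\Delta$, $$\frac{1}{N(\hbar)}\sum_{j=1}^{N(\hbar)}\left|\int_{\mathbb{T}^d}a\,|\psi_\hbar^j|^2\,dx-\int_{\mathbb{T}^d}a\,dx\right|^2\leq C_a\,\hbar^{\frac{2}{3}}.$$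
   Context: $\mathbb{T}^d=\mathbb{R}^d/\mathbb{Z}^d$ carries the standard flat metric, $\Delta$ is its Laplacian, and $dx$ is the normalized volume measure. The number $\alpha>0$ is fixed once and for all (constants may depend on $\alpha$ and $d$). For $0<\hbar\leq 1$, $\mathcal{H}_\hbar:=\mathbf{1}_{[1-\alpha\hbar,1+\alpha\hbar]}(-\hbar^2\Delta)L^2(\mathbb{T}^d)$ is the range of the spectral projector of $-\hbar^2\Delta$ onto the interval $[1-\alpha\hbar,1+\alpha\hbar]$, i.e. the (finite-dimensional) span of the eigenfunctions of $-\hbar^2\Delta$ with eigenvalue in this interval, and $N(\hbar):=\dim\mathcal{H}_\hbar$. An orthonormal basis made of eigenfunctions means that each $\psi_\hbar^j$ satisfies $-\hbar^2\Delta\psi_\hbar^j=E_j(\hbar)\psi_\hbar^j$ for some $E_j(\hbar)\in[1-\alpha\hbar,1+\alpha\hbar]$. *)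

theory Defs
  imports "HOL-Analysis.Analysis"
begin

section \<open>Smooth functions on the torus\<close>

text \<open>
  The torus \<open>\<real>\<^sup>d/\<int>\<^sup>d\<close> is indexed by a finite type \<open>'n\<close> with \<open>d = CARD('n)\<close>.
  A smooth function on it is a smooth \<open>\<int>\<^sup>d\<close>-periodic function on \<open>\<real>\<^sup>d\<close>.
\<close>

primrec Ck :: "nat \<Rightarrow> (real ^ 'n::finite \<Rightarrow> complex) \<Rightarrow> bool" where
  "Ck 0 f \<longleftrightarrow> continuous_on UNIV f"
| "Ck (Suc k) f \<longleftrightarrow> (\<forall>x. f differentiable (at x)) \<and>
     (\<forall>v. Ck k (\<lambda>x. frechet_derivative f (at x) v))"

definition torus_smooth :: "(real ^ 'n::finite \<Rightarrow> complex) \<Rightarrow> bool" where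
  "torus_smooth f \<longleftrightarrow> (\<forall>k. Ck k f) \<and>
     (\<forall>x z. (\<forall>i. z $ i \<in> \<int>) \<longrightarrow> f (x + z) = f x)"

definition partial_deriv :: "'n \<Rightarrow> (real ^ 'n::finite \<Rightarrow> complex) \<Rightarrow> real ^ 'n \<Rightarrow> complex" where
  "partial_deriv i f x = frechet_derivative f (at x) (axis i 1)"

definition smooth_laplacian :: "(real ^ 'n::finite \<Rightarrow> complex) \<Rightarrow> real ^ 'n \<Rightarrow> complex" where
  "smooth_laplacian f x = (\<Sum>i\<in>UNIV. partial_deriv i (partial_deriv i f) x)"

section \<open>The Hilbert space of square integrable functions on the torus\<close>

text \<open>
  The volume measure of the torus, carried by the fundamental domain \<open>[0,1)\<^sup>d\<close>; its total mass is 1.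
\<close>

definition torus :: "(real ^ 'n::finite) measure" where
  "torus = restrict_space lborel {x. \<forall>i. 0 \<le> x $ i \<and> x $ i < 1}"

definition square_integrable :: "(real ^ 'n::finite \<Rightarrow> complex) \<Rightarrow> bool" where
  "square_integrable f \<longleftrightarrow> f \<in> borel_measurable torus \<and> integrable torus (\<lambda>x. (cmod (f x))\<^sup>2)"

lemma square_integrable_0: "square_integrable (\<lambda>x. 0)"
  by (simp add: square_integrable_def)

lemma square_integrable_add:
  assumes "square_integrable f" "square_integrable g"
  shows "square_integrable (\<lambda>x. f x + g x)"
proof -
  have [measurable]: "f \<in> borel_measurable torus" "g \<in> borel_measurable torus"
    using assms by (auto simp: square_integrable_def)
  have "integrable torus (\<lambda>x. 2 * (cmod (f x))\<^sup>2 + 2 * (cmod (g x))\<^sup>2)"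
    using assms by (auto simp: square_integrable_def)
  moreover have "(cmod (f x + g x))\<^sup>2 \<le> 2 * (cmod (f x))\<^sup>2 + 2 * (cmod (g x))\<^sup>2" for x
  proof -
    have "(cmod (f x + g x))\<^sup>2 \<le> (cmod (f x) + cmod (g x))\<^sup>2"
      by (simp add: norm_triangle_ineq power_mono)
    also have "\<dots> \<le> 2 * (cmod (f x))\<^sup>2 + 2 * (cmod (g x))\<^sup>2"
      using zero_le_power2[of "cmod (f x) - cmod (g x)"]
      by (simp add: power2_eq_square algebra_simps)
    finally show ?thesis .
  qed
  ultimately have "integrable torus (\<lambda>x. (cmod (f x + g x))\<^sup>2)"
    by (elim Bochner_Integration.integrable_bound) auto
  then show ?thesis
    by (simp add: square_integrable_def)
qed

lemma square_integrable_scale: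
  assumes "square_integrable f"
  shows "square_integrable (\<lambda>x. c * f x)"
  using assms by (auto simp: square_integrable_def norm_mult power_mult_distrib)

lemma square_integrable_uminus: "square_integrable f \<Longrightarrow> square_integrable (\<lambda>x. - f x)"
  using square_integrable_scale[of f "- 1"] by simp

definition ae_equal :: "(real ^ 'n::finite \<Rightarrow> complex) \<Rightarrow> (real ^ 'n \<Rightarrow> complex) \<Rightarrow> bool" where
  "ae_equal f g \<longleftrightarrow> square_integrable f \<and> square_integrable g \<and> (AE x in torus. f x = g x)"

lemma part_equivp_ae_equal: "part_equivp ae_equal"
proof (rule part_equivpI)
  show "\<exists>f. ae_equal f f"
    using square_integrable_0 by (auto simp: ae_equal_def)
  show "symp ae_equal"
    by (auto simp: symp_def ae_equal_def elim: eventually_mono)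
  show "transp ae_equal"
    unfolding transp_def ae_equal_def by (auto elim: eventually_elim2)
qed

quotient_type 'n l2 = "real ^ ('n::finite) \<Rightarrow> complex" / partial: ae_equal
  morphisms l2_rep l2_class
  by (rule part_equivp_ae_equal)

text \<open>
  \<^term>\<open>l2_rep u\<close> is a representative of the class \<open>u\<close>. It occurs below only inside integrals
  against measurable functions, whose values do not depend on the representative.
\<close>

instantiation l2 :: (finite) ab_group_add
begin

lift_definition zero_l2 :: "'a l2" is "\<lambda>x. 0"
  by (simp add: ae_equal_def square_integrable_0)

lift_definition plus_l2 :: "'a l2 \<Rightarrow> 'a l2 \<Rightarrow> 'a l2" is "\<lambda>f g x. f x + g x"
  unfolding ae_equal_def by (auto intro: square_integrable_add elim: eventually_elim2)

lift_definition uminus_l2 :: "'a l2 \<Rightarrow> 'a l2" is "\<lambda>f x. - f x"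
  unfolding ae_equal_def by (auto intro: square_integrable_uminus elim: eventually_mono)

definition minus_l2 :: "'a l2 \<Rightarrow> 'a l2 \<Rightarrow> 'a l2" where
  "minus_l2 u v = u + - v"

instance
proof
  fix u v w :: "'a l2"
  show "u + v + w = u + (v + w)"
    by transfer (auto simp: ae_equal_def add.assoc intro!: square_integrable_add)
  show "u + v = v + u"
    by transfer (auto simp: ae_equal_def add.commute intro!: square_integrable_add)
  show "0 + u = u"
    by transfer (auto simp: ae_equal_def)
  show "- u + u = 0"
    by transfer (auto simp: ae_equal_def square_integrable_0)
  show "u - v = u + - v"
    by (simp add: minus_l2_def)
qed

end

lift_definition l2_scale :: "complex \<Rightarrow> 'n::finite l2 \<Rightarrow> 'n l2" is "\<lambda>c f x. c * f x"
  unfolding ae_equal_def by (auto intro: square_integrable_scale elim: eventually_mono)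

interpretation l2: vector_space l2_scale
proof
  fix a b :: complex and u v :: "'n::finite l2"
  show "l2_scale a (u + v) = l2_scale a u + l2_scale a v"
    by transfer (auto simp: ae_equal_def ring_distribs
        intro!: square_integrable_add square_integrable_scale)
  show "l2_scale (a + b) u = l2_scale a u + l2_scale b u"
    by transfer (auto simp: ae_equal_def ring_distribs
        intro!: square_integrable_add square_integrable_scale)
  show "l2_scale a (l2_scale b u) = l2_scale (a * b) u"
    by transfer (auto simp: ae_equal_def mult.assoc intro!: square_integrable_scale)
  show "l2_scale 1 u = u"
    by transfer (auto simp: ae_equal_def)
qed

definition l2_inner :: "'n::finite l2 \<Rightarrow> 'n l2 \<Rightarrow> complex" where
  "l2_inner u v = (LINT x|torus. l2_rep u x * cnj (l2_rep v x))"

section \<open>The Laplacian and its spectral subspaces\<close>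

text \<open>
  The graph of the self-adjoint Laplacian on \<open>L\<^sup>2\<close>: \<open>u\<close> lies in its domain (the Sobolev space
  \<open>H\<^sup>2\<close>) and is mapped to \<open>w\<close> iff the distributional Laplacian of \<open>u\<close> is \<open>w \<in> L\<^sup>2\<close>.
\<close>

definition has_laplacian :: "'n::finite l2 \<Rightarrow> 'n l2 \<Rightarrow> bool" where
  "has_laplacian u w \<longleftrightarrow> (\<forall>\<phi>. torus_smooth \<phi> \<longrightarrow>
     (LINT x|torus. l2_rep u x * smooth_laplacian \<phi> x) = (LINT x|torus. l2_rep w x * \<phi> x))"

definition eigenfunction :: "real \<Rightarrow> real \<Rightarrow> 'n::finite l2 \<Rightarrow> bool" where
  "eigenfunction h E u \<longleftrightarrow> u \<noteq> 0 \<and>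
     (\<exists>w. has_laplacian u w \<and> l2_scale (of_real (- h\<^sup>2)) w = l2_scale (of_real E) u)"

text \<open>
  The range of the spectral projector of \<open>- h\<^sup>2 \<Delta>\<close> onto \<open>[1 - \<alpha>h, 1 + \<alpha>h]\<close>. The spectrum is
  discrete with finite multiplicities, so no closure of the span is needed.
\<close>

definition spectral_space :: "real \<Rightarrow> real \<Rightarrow> 'n::finite l2 set" where
  "spectral_space \<alpha> h = l2.span {u. \<exists>E\<in>{1 - \<alpha> * h..1 + \<alpha> * h}. eigenfunction h E u}"

definition eigenbasis :: "real \<Rightarrow> real \<Rightarrow> nat \<Rightarrow> (nat \<Rightarrow> 'n::finite l2) \<Rightarrow> bool" where
  "eigenbasis \<alpha> h N \<psi> \<longleftrightarrow>
     (\<forall>i\<in>{1..N}. \<forall>j\<in>{1..N}. l2_inner (\<psi> i) (\<psi> j) = (if i = j then 1 else 0)) \<and>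
     l2.span (\<psi> ` {1..N}) = spectral_space \<alpha> h \<and>
     (\<forall>j\<in>{1..N}. \<exists>E\<in>{1 - \<alpha> * h..1 + \<alpha> * h}. eigenfunction h E (\<psi> j))"

end

theory Submission imports Defs begin

text \<open>
  An eigenfunction on the torus is a trigonometric polynomial with frequencies on one sphere of
  \<open>\<int>\<^sup>d\<close>, so for an orthonormal eigenbasis with Fourier coefficients \<open>c\<^sub>j(k)\<close> the quantity to be
  averaged is the squared modulus of the finite sum over \<open>m \<noteq> 0\<close> of \<open>a\<^sub>m B\<^sub>j(m)\<close>, where \<open>a\<^sub>m\<close> is
  the \<open>m\<close>-th Fourier coefficient of \<open>a\<close> and \<open>B\<^sub>j(m)\<close> sums
  \<open>c\<^sub>j(k) cnj (c\<^sub>j(k + m))\<close> over the frequencies \<open>k\<close> with \<open>|k + m| = |k|\<close>. Cauchy-Schwarz and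
  Bessel bound the sum of \<open>|B\<^sub>j(m)|\<^sup>2\<close> over \<open>j\<close> by the number of lattice points in the intersection
  of the spectral shell, of radius \<open>R = 1 / (2\<pi>h)\<close> and bounded width, with the hyperplane
  \<open>|k + m| = |k|\<close>. That number is at most \<open>C |m|\<^sup>2 R\<^sup>d\<^sup>-\<^sup>2\<close>, whereas the whole shell contains at
  least \<open>c R\<^sup>d\<^sup>-\<^sup>1\<close> points. As \<open>a\<^sub>m\<close> decays rapidly, the average is even \<open>O(h)\<close>, and
  \<open>h \<le> h powr (2/3)\<close>.
\<close>

section \<open>Integration over the torus\<close>

text \<open>Eigenspaces may be highly degenerate and the basis is arbitrary in each of them, so
  little is known about a single coefficient vector; what can be used is orthonormality in
  \<open>j\<close>, and it enters one frequency at a time. The gain is arithmetic: a hyperplane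
  section of a shell has one dimension less than the shell, which is worth a factor
  \<open>1 / R = 2 * pi * h\<close>.

  Two obstacles shape the rest. Eigenfunctions are given through the distributional Laplacian, so
  testing against characters only locates their Fourier coefficients; that the function equals the
  corresponding finite sum requires uniqueness for Fourier series, which is derived here from the
  Stone-Weierstrass theorem on an embedded torus. Moreover \<open>h\<close> runs up to 1, so
  \<open>R\<close> descends to \<open>1 / (2 * pi)\<close>, where the asymptotic lower bound for the
  number of shell points says nothing; there \<open>N \<ge> 1\<close> takes its place.\<close>

definition torus_cube :: "(real ^ 'n::finite) set" where
  "torus_cube = {x. \<forall>i. 0 \<le> x $ i \<and> x $ i < 1}"

lemma torus_eq: "torus = restrict_space lborel torus_cube"
  by (simp add: torus_def torus_cube_def)

lemma torus_cube_borel [measurable]: "torus_cube \<in> sets borel"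
proof -
  have eq: "torus_cube = (\<Inter>i. {x :: real^'n. 0 \<le> x $ i} \<inter> {x. x $ i < 1})" by (auto simp: torus_cube_def)
  have "{x :: real^'n. 0 \<le> x $ i} \<inter> {x. x $ i < 1} \<in> sets borel" for i
    by (intro sets.Int borel_open borel_closed open_Collect_less closed_Collect_le continuous_intros)
  then show ?thesis unfolding eq by (intro sets.finite_INT) auto
qed

lemma space_torus [simp]: "space torus = torus_cube"
  by (simp add: torus_eq space_restrict_space)

lemma borel_measurable_torusI [measurable (raw)]: "f \<in> borel_measurable borel \<Longrightarrow> f \<in> borel_measurable torus"
  unfolding torus_eq by (rule measurable_restrict_space1) simp

lemma torus_cube_subset_cbox: "torus_cube \<subseteq> cbox 0 (1 :: real^'n::finite)"
  by (auto simp: torus_cube_def mem_box_cart less_imp_le)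

lemma emeasure_lborel_torus_cube: "emeasure lborel (torus_cube :: (real^'n::finite) set) = 1"
proof (rule antisym)
  have B: "(1 - 0) \<bullet> b = (1::real)" if "b \<in> (Basis :: (real^'n) set)" for b
    using that by (auto simp: Basis_vec_def inner_axis)
  have c: "emeasure lborel (cbox 0 (1 :: real^'n)) = 1" 
    by (subst emeasure_lborel_cbox) (auto simp: B[simplified])
  have o: "emeasure lborel (box 0 (1 :: real^'n)) = 1" 
    by (subst emeasure_lborel_box) (auto simp: B[simplified])
  show "emeasure lborel (torus_cube :: (real^'n) set) \<le> 1"
    unfolding c[symmetric] by (rule emeasure_mono[OF torus_cube_subset_cbox]) auto
  show "1 \<le> emeasure lborel (torus_cube :: (real^'n) set)"
    unfolding o[symmetric] using torus_cube_borel by (intro emeasure_mono) (auto simp: torus_cube_def mem_box_cart less_imp_le)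
qed

lemma emeasure_space_torus: "emeasure torus (torus_cube :: (real^'n::finite) set) = 1"
  unfolding torus_eq by (subst emeasure_restrict_space) (auto simp: emeasure_lborel_torus_cube)

lemma finite_measure_torus: "finite_measure (torus :: (real^'n::finite) measure)"
  by standard (simp add: emeasure_space_torus)

interpretation torus: finite_measure torus by (rule finite_measure_torus)

lemma measure_space_torus [simp]: "measure torus torus_cube = 1"
  by (simp add: measure_def emeasure_space_torus)

lemma integral_torus_lborel:
  fixes f :: "real^'n::finite \<Rightarrow> 'b::euclidean_space"
  shows "(LINT x|torus. f x) = (LINT x|lborel. indicator torus_cube x *\<^sub>R f x)"
  unfolding torus_eq by (subst integral_restrict_space) auto

lemma continuous_bounded_torus:
  fixes f :: "real^'n::finite \<Rightarrow> 'b::euclidean_space"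
  assumes "continuous_on UNIV f"
  obtains B where "B > 0" "\<And>x. x \<in> torus_cube \<Longrightarrow> norm (f x) \<le> B"
proof -
  have "compact (f ` cbox 0 1)"
    by (rule compact_continuous_image) (auto intro: continuous_on_subset[OF assms])
  then obtain B where B: "B > 0" "\<forall>y\<in>f ` cbox 0 1. norm y \<le> B"
    using compact_imp_bounded bounded_pos by blast
  show ?thesis
  proof (rule that[OF B(1)])
    fix x :: "real^'n" assume "x \<in> torus_cube"
    then show "norm (f x) \<le> B" using B(2) torus_cube_subset_cbox by blast
  qed
qed

lemma integrable_torus_continuous:
  fixes f :: "real^'n::finite \<Rightarrow> 'b::euclidean_space"
  assumes "continuous_on UNIV f"
  shows "integrable torus f"
proof -
  obtain B where "B > 0" "\<And>x. x \<in> torus_cube \<Longrightarrow> norm (f x) \<le> B"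
    using continuous_bounded_torus[OF assms] by metis
  then show ?thesis
    by (intro torus.integrable_const_bound[of _ B] AE_I2 borel_measurable_torusI
        borel_measurable_continuous_onI assms) auto
qed

lemma square_integrable_imp_integrable:
  assumes "square_integrable f" shows "integrable torus f"
proof -
  have "integrable torus (\<lambda>x. 1 + (cmod (f x))\<^sup>2)"
    using assms by (auto simp: square_integrable_def)
  moreover have "cmod (f x) \<le> 1 + (cmod (f x))\<^sup>2" for x
    using zero_le_power2[of "cmod (f x) - 1"] norm_ge_zero[of "f x"]
    unfolding power2_diff one_power2 by linarith
  ultimately show ?thesis using assms
    by (elim Bochner_Integration.integrable_bound) (auto simp: square_integrable_def)
qed

lemma square_integrable_continuous:
  assumes "continuous_on UNIV f" shows "square_integrable f"
  unfolding square_integrable_def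
  by (intro conjI borel_measurable_torusI borel_measurable_continuous_onI assms
      integrable_torus_continuous continuous_intros)

lemma integrable_torus_mult_continuous:
  fixes f g :: "real^'n::finite \<Rightarrow> complex"
  assumes "integrable torus f" "continuous_on UNIV g"
  shows "integrable torus (\<lambda>x. f x * g x)"
proof -
  obtain B where B: "B > 0" "\<And>x. x \<in> torus_cube \<Longrightarrow> norm (g x) \<le> B"
    using continuous_bounded_torus[OF assms(2)] by metis
  have [measurable]: "g \<in> borel_measurable torus"
    by (intro borel_measurable_torusI borel_measurable_continuous_onI assms)
  have "integrable torus (\<lambda>x. B * cmod (f x))" using assms(1) by auto
  then show ?thesis
    by (rule Bochner_Integration.integrable_bound)
      (use assms(1) B in \<open>auto intro!: AE_I2 mult_left_mono simp: norm_mult mult.commute[of B]\<close>)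
qed

section \<open>Translation invariance and vanishing of the mean of a derivative\<close>

lemma integral_lborel_translate:
  fixes f :: "real^'n::finite \<Rightarrow> 'b::euclidean_space"
  assumes [measurable]: "f \<in> borel_measurable borel"
  shows "(LINT x|lborel. f (x + c)) = (LINT x|lborel. f x)"
proof -
  have "(LINT x|lborel. f x) = (LINT x|distr lborel borel ((+) c). f x)"
    by (simp add: lborel_distr_plus)
  also have "\<dots> = (LINT x|lborel. f (c + x))"
    by (rule integral_distr) auto
  finally show ?thesis by (simp add: add.commute)
qed

text \<open>The translated cube splits in two: the part still inside the cube is \<open>A\<close>,
  and the part that crosses the face \<open>x $ i = 1\<close> is moved back by one period onto
  \<open>B\<close>. Together \<open>A\<close> and \<open>B\<close> partition the cube.\<close>

lemma integral_torus_translate: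
  fixes g :: "real^'n::finite \<Rightarrow> complex"
  assumes g: "continuous_on UNIV g" and per: "\<And>x. g (x + axis i 1) = g x" and t: "0 \<le> t" "t \<le> 1"
  shows "(LINT x|torus. g (x + t *\<^sub>R axis i 1)) = (LINT x|torus. g x)"
proof -
  define v :: "real^'n" where "v = axis i 1"
  have v: "v $ j = (if j = i then 1 else 0)" for j by (simp add: v_def axis_def)
  have [measurable]: "g \<in> borel_measurable borel" using g by (rule borel_measurable_continuous_onI)
  have [measurable]: "(\<lambda>x::real^'n. x $ j) \<in> borel_measurable borel" for j
    by (intro borel_measurable_continuous_onI continuous_intros)
  define A B where "A = torus_cube \<inter> {x. x $ i \<ge> t}" and "B = torus_cube \<inter> {x. x $ i < t}"
  have [measurable]: "A \<in> sets borel" "B \<in> sets borel" unfolding A_def B_def by measurable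
  have AB: "A \<subseteq> cbox 0 1" "B \<subseteq> cbox 0 1" using torus_cube_subset_cbox by (auto simp: A_def B_def)
  have int: "integrable lborel (\<lambda>x. indicator S x *\<^sub>R f x)" 
    if "S \<in> sets borel" "S \<subseteq> cbox a b" "continuous_on UNIV f" for S and a b :: "real^'n" and f :: "real^'n \<Rightarrow> complex"
  proof -
    have "integrable lborel (\<lambda>x. indicator (cbox a b) x *\<^sub>R f x)"
      using borel_integrable_compact[of "cbox a b" f] continuous_on_subset[OF that(3)] by auto
    then show ?thesis
      by (rule Bochner_Integration.integrable_bound)
       (use that borel_measurable_continuous_onI[OF that(3)] in \<open>auto simp: indicator_def intro!: AE_I2\<close>)
  qed
  have ct: "continuous_on UNIV (\<lambda>x. g (x + c))" for c
    by (rule continuous_on_compose2[OF g]) (auto intro!: continuous_intros)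
  have "(LINT x|torus. g (x + t *\<^sub>R v)) = (LINT x|lborel. indicator torus_cube x *\<^sub>R g (x + t *\<^sub>R v))"
    by (rule integral_torus_lborel)
  also have "\<dots> = (LINT x|lborel. indicator torus_cube (x - t *\<^sub>R v) *\<^sub>R g x)"
    by (subst integral_lborel_translate[where c = "t *\<^sub>R v", symmetric]) auto
  also have "\<dots> = (LINT x|lborel. indicator A x *\<^sub>R g x + indicator B (x - v) *\<^sub>R g x)"
  proof (rule Bochner_Integration.integral_cong)
    fix x :: "real^'n"
    define P where "P \<longleftrightarrow> (\<forall>j. j \<noteq> i \<longrightarrow> 0 \<le> x $ j \<and> x $ j < 1)"
    have split: "y \<in> torus_cube \<longleftrightarrow> (\<forall>j. j \<noteq> i \<longrightarrow> 0 \<le> y $ j \<and> y $ j < 1) \<and> 0 \<le> y $ i \<and> y $ i < 1"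
      for y :: "real^'n"
    proof -
      have "(\<forall>j. Q j) \<longleftrightarrow> (\<forall>j. j \<noteq> i \<longrightarrow> Q j) \<and> Q i" for Q by metis
      from this[of "\<lambda>j. 0 \<le> y $ j \<and> y $ j < 1"] show ?thesis by (simp add: torus_cube_def)
    qed
    have "x - t *\<^sub>R v \<in> torus_cube \<longleftrightarrow> P \<and> t \<le> x $ i \<and> x $ i < 1 + t"
      by (auto simp: split v P_def)
    moreover have "x \<in> A \<longleftrightarrow> P \<and> t \<le> x $ i \<and> x $ i < 1"
      using t by (auto simp: A_def split P_def)
    moreover have "x - v \<in> B \<longleftrightarrow> P \<and> 1 \<le> x $ i \<and> x $ i < 1 + t"
      using t by (auto simp: B_def split P_def v)
    ultimately have "x - t *\<^sub>R v \<in> torus_cube \<longleftrightarrow> x \<in> A \<or> x - v \<in> B" "\<not> (x \<in> A \<and> x - v \<in> B)"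
      using t by auto
    then show "indicator torus_cube (x - t *\<^sub>R v) *\<^sub>R g x = indicator A x *\<^sub>R g x + indicator B (x - v) *\<^sub>R g x"
      by (auto simp: indicator_def)
  qed simp
  also have "\<dots> = (LINT x|lborel. indicator A x *\<^sub>R g x) + (LINT x|lborel. indicator B (x - v) *\<^sub>R g x)"
  proof (rule Bochner_Integration.integral_add)
    show "integrable lborel (\<lambda>x. indicator A x *\<^sub>R g x)" using int[OF _ AB(1) g] by simp
    have "(\<lambda>x. x - v) -` B \<in> sets borel" 
      using measurable_sets[of "\<lambda>x. x - v" borel borel B] by simp
    moreover have "(\<lambda>x. x - v) -` B \<subseteq> cbox v (1 + v)"
    proof
      fix x assume "x \<in> (\<lambda>x. x - v) -` B"
      then have "x - v \<in> cbox 0 1" using AB(2) by auto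
      then show "x \<in> cbox v (1 + v)" by (simp add: mem_box_cart algebra_simps)
    qed
    ultimately have "integrable lborel (\<lambda>x. indicator ((\<lambda>x. x - v) -` B) x *\<^sub>R g x)"
      using int g by blast
    then show "integrable lborel (\<lambda>x. indicator B (x - v) *\<^sub>R g x)"
      by (simp add: indicator_def)
  qed
  also have "(LINT x|lborel. indicator B (x - v) *\<^sub>R g x) = (LINT x|lborel. indicator B x *\<^sub>R g x)"
    by (subst integral_lborel_translate[where c = v, symmetric]) (auto simp: per v_def)
  also have "(LINT x|lborel. indicator A x *\<^sub>R g x) + (LINT x|lborel. indicator B x *\<^sub>R g x)
      = (LINT x|lborel. indicator A x *\<^sub>R g x + indicator B x *\<^sub>R g x)"
    by (subst Bochner_Integration.integral_add) (auto intro: int[OF _ AB(1) g] int[OF _ AB(2) g])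
  also have "\<dots> = (LINT x|lborel. indicator torus_cube x *\<^sub>R g x)"
    by (rule Bochner_Integration.integral_cong) (auto simp: A_def B_def indicator_def)
  also have "\<dots> = (LINT x|torus. g x)" by (rule integral_torus_lborel[symmetric])
  finally show ?thesis by (simp add: v_def)
qed

text \<open>By translation invariance every difference quotient along the axis has integral 0, and
  dominated convergence carries this over to the derivative. The mean value inequality on segments
  supplies the constant dominating function.\<close>

lemma integral_torus_partial_derivative_eq_0:
  fixes g :: "real^'n::finite \<Rightarrow> complex"
  assumes d: "\<And>x. (g has_derivative g' x) (at x)" 
    and c: "continuous_on UNIV (\<lambda>x. g' x (axis i 1))" 
    and per: "\<And>x. g (x + axis i 1) = g x"
  shows "(LINT x|torus. g' x (axis i 1)) = 0"
proof -
  define v :: "real^'n" where "v = axis i 1"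
  define s where "s n = inverse (real (Suc n))" for n
  have s: "0 < s n" "s n \<le> 1" for n by (auto simp: s_def field_simps)
  have g: "continuous_on UNIV g"
    using d by (meson continuous_at_imp_continuous_on has_derivative_continuous)
  have ct: "continuous_on UNIV (\<lambda>x. g (x + c))" for c
    by (rule continuous_on_compose2[OF g]) (auto intro!: continuous_intros)
  \<comment> \<open>Segments of length at most 1 that start in the unit cube may leave it, hence the
    larger box.\<close>
  have "compact ((\<lambda>x. g' x v) ` cbox 0 2)"
    by (rule compact_continuous_image) (auto intro: continuous_on_subset[OF c] simp: v_def)
  then obtain M where M: "M > 0" "\<forall>y\<in>cbox 0 2. norm (g' y v) \<le> M"
    using compact_imp_bounded bounded_pos by (metis (no_types, lifting) image_eqI)
  define q where "q n x = (g (x + s n *\<^sub>R v) - g x) /\<^sub>R s n" for n x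
  have q0: "(LINT x|torus. q n x) = 0" for n
  proof -
    have "(LINT x|torus. q n x) = ((LINT x|torus. g (x + s n *\<^sub>R v)) - (LINT x|torus. g x)) /\<^sub>R s n"
      unfolding q_def by (simp add: Bochner_Integration.integral_diff integrable_torus_continuous g ct)
    then show ?thesis using integral_torus_translate[OF g per, of "s n"] s[of n] by (simp add: v_def)
  qed
  have line: "((\<lambda>t. g (x + t *\<^sub>R v)) has_vector_derivative g' (x + t *\<^sub>R v) v) (at t within S)" for x t S
  proof -
    have "((\<lambda>t. x + t *\<^sub>R v) has_derivative (\<lambda>t. t *\<^sub>R v)) (at t within S)"
      by (auto intro!: derivative_eq_intros)
    then have "((\<lambda>t. g (x + t *\<^sub>R v)) has_derivative (\<lambda>u. g' (x + t *\<^sub>R v) (u *\<^sub>R v))) (at t within S)"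
      by (rule has_derivative_compose) (rule d)
    then show ?thesis
      using has_derivative_bounded_linear[OF d] 
      by (simp add: has_vector_derivative_def linear_simps bounded_linear.linear linear_cmul)
  qed
  have "(\<lambda>n. LINT x|torus. q n x) \<longlonglongrightarrow> (LINT x|torus. g' x v)"
  proof (rule integral_dominated_convergence[where w = "\<lambda>_. M"])
    show "(\<lambda>x. g' x v) \<in> borel_measurable torus"
      using c by (intro borel_measurable_torusI borel_measurable_continuous_onI) (simp add: v_def)
    show "q n \<in> borel_measurable torus" for n
      unfolding q_def by (intro borel_measurable_torusI borel_measurable_continuous_onI continuous_intros g ct)
    show "integrable torus (\<lambda>_. M)" by simp
    show "AE x in torus. (\<lambda>n. q n x) \<longlonglongrightarrow> g' x v"
    proof (rule AE_I2)
      fix x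
      have "((\<lambda>t. (g (x + t *\<^sub>R v) - g x) /\<^sub>R t) \<longlongrightarrow> g' x v) (at 0)"
      proof -
        have "((\<lambda>u. norm ((g (x + u *\<^sub>R v) - g x) - u *\<^sub>R g' x v) / norm u) \<longlongrightarrow> 0) (at 0)"
          using line[of x 0 UNIV] by (simp add: has_vector_derivative_def has_derivative_iff_norm)
        moreover have "\<forall>\<^sub>F u in at 0. norm ((g (x + u *\<^sub>R v) - g x) - u *\<^sub>R g' x v) / norm u
            = norm ((g (x + u *\<^sub>R v) - g x) /\<^sub>R u - g' x v)"
        proof -
          have "norm ((g (x + u *\<^sub>R v) - g x) - u *\<^sub>R g' x v) / norm u
            = norm ((g (x + u *\<^sub>R v) - g x) /\<^sub>R u - g' x v)" if "u \<noteq> 0" for u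
          proof -
            have "(g (x + u *\<^sub>R v) - g x) - u *\<^sub>R g' x v = u *\<^sub>R ((g (x + u *\<^sub>R v) - g x) /\<^sub>R u - g' x v)"
              using that by (simp add: scaleR_diff_right)
            then show ?thesis using that by (simp add: norm_scaleR)
          qed
          then show ?thesis by (auto simp: eventually_at_filter)
        qed
        ultimately have "((\<lambda>u. norm ((g (x + u *\<^sub>R v) - g x) /\<^sub>R u - g' x v)) \<longlongrightarrow> 0) (at 0)"
          by (rule Lim_transform_eventually)
        then show ?thesis
          by (subst (asm) tendsto_norm_zero_iff) (simp add: LIM_zero_iff)
      qed
      moreover have "filterlim s (at 0) sequentially"
        unfolding filterlim_at using s LIMSEQ_inverse_real_of_nat by (auto simp: s_def[abs_def] less_imp_neq)
      ultimately show "(\<lambda>n. q n x) \<longlonglongrightarrow> g' x v" 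
        unfolding q_def by (rule filterlim_compose)
    qed
    show "AE x in torus. norm (q n x) \<le> M" for n
    proof (rule AE_I2)
      fix x :: "real^'n" assume "x \<in> space torus"
      then have x: "\<And>j. 0 \<le> x $ j \<and> x $ j < 1" by (auto simp: torus_cube_def)
      have "norm (g (x + s n *\<^sub>R v) - g (x + 0 *\<^sub>R v)) \<le> M * norm (s n - 0)"
      proof (rule differentiable_bound[where S = "{0..1}" and f = "\<lambda>t. g (x + t *\<^sub>R v)" and f' = "\<lambda>t u. u *\<^sub>R g' (x + t *\<^sub>R v) v"])
        fix t :: real assume t: "t \<in> {0..1}"
        show "((\<lambda>t. g (x + t *\<^sub>R v)) has_derivative (\<lambda>u. u *\<^sub>R g' (x + t *\<^sub>R v) v)) (at t within {0..1})"
          using line by (simp add: has_vector_derivative_def)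
        have "x + t *\<^sub>R v \<in> cbox 0 2"
          using x t by (auto simp: mem_box_cart v_def axis_def add_nonneg_nonneg) (smt (verit) x)+
        then show "onorm (\<lambda>u. u *\<^sub>R g' (x + t *\<^sub>R v) v) \<le> M"
          using M by (simp add: onorm_scaleR_left onorm_id bounded_linear_ident)
      qed (use s[of n] in auto)
      then show "norm (q n x) \<le> M" using s[of n]
        by (simp add: q_def divide_simps mult.commute)
    qed
  qed
  then show ?thesis by (simp add: q0 v_def LIMSEQ_const_iff)
qed

section \<open>Characters and Fourier coefficients\<close>

definition lattice_vec :: "int ^ 'n::finite \<Rightarrow> real ^ 'n" where
  "lattice_vec k = (\<chi> i. real_of_int (k $ i))"

lemma lattice_vec_nth [simp]: "lattice_vec k $ i = real_of_int (k $ i)"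
  by (simp add: lattice_vec_def)

lemma lattice_vec_add: "lattice_vec (k + l) = lattice_vec k + lattice_vec l"
  and lattice_vec_minus: "lattice_vec (- k) = - lattice_vec k"
  and lattice_vec_0 [simp]: "lattice_vec 0 = 0"
  by (auto simp: vec_eq_iff)

lemma norm_lattice_vec: "(norm (lattice_vec k))\<^sup>2 = (\<Sum>i\<in>UNIV. (real_of_int (k $ i))\<^sup>2)"
  unfolding power2_norm_eq_inner inner_vec_def by (simp add: power2_eq_square)

definition char :: "int ^ 'n::finite \<Rightarrow> real ^ 'n \<Rightarrow> complex" where
  "char k x = cis (2 * pi * (lattice_vec k \<bullet> x))"

lemma char_0 [simp]: "char 0 x = 1" by (simp add: char_def)
lemma norm_char [simp]: "cmod (char k x) = 1" by (simp add: char_def)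
lemma char_add: "char (k + l) x = char k x * char l x"
  by (simp add: char_def cis_mult lattice_vec_add algebra_simps inner_add_left)
lemma char_minus: "char (- k) x = cnj (char k x)"
  by (simp add: char_def cis_cnj lattice_vec_minus)
lemma char_diff: "char (k - l) x = char k x * cnj (char l x)"
  using char_add[of k "- l" x] by (simp add: char_minus)

lemma char_periodic:
  assumes "\<forall>i. z $ i \<in> \<int>" shows "char k (x + z) = char k x"
proof -
  have "lattice_vec k \<bullet> z \<in> \<int>"
    using assms by (auto simp: inner_vec_def intro!: Ints_sum Ints_mult)
  then have "cis (2 * pi * (lattice_vec k \<bullet> z)) = 1" by simp
  then show ?thesis by (simp add: char_def inner_add_right ring_distribs flip: cis_mult)
qed

lemma has_derivative_char:
  "((\<lambda>x. c * char k x) has_derivative (\<lambda>v. (c * (2 * pi * (lattice_vec k \<bullet> v)) * \<i>) * char k x)) (at x)"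
  unfolding char_def
  by (rule derivative_eq_intros refl | simp)+ (simp add: fun_eq_iff scaleR_conv_of_real algebra_simps)

lemma frechet_derivative_char:
  "frechet_derivative (\<lambda>x. c * char k x) (at x) = (\<lambda>v. (c * (2 * pi * (lattice_vec k \<bullet> v)) * \<i>) * char k x)"
  using frechet_derivative_at[OF has_derivative_char] by metis

lemma continuous_on_char [continuous_intros]: "continuous_on S (char k)"
  unfolding char_def by (intro continuous_intros)

lemma Ck_char: "Ck m (\<lambda>x. c * char k x)"
proof (induction m arbitrary: c)
  case 0
  show ?case by (auto intro!: continuous_intros)
next
  case (Suc m)
  have "(\<lambda>x. c * char k x) differentiable (at x)" for x
    using has_derivative_char differentiable_def by blast
  then show ?case using Suc by (simp add: frechet_derivative_char)
qed

lemma torus_smooth_char: "torus_smooth (char k)"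
  unfolding torus_smooth_def
proof (intro conjI allI impI)
  show "Ck m (char k)" for m using Ck_char[of m 1 k] by simp
qed (rule char_periodic)

lemma smooth_laplacian_char:
  "smooth_laplacian (char k) x = - of_real (4 * pi\<^sup>2 * (norm (lattice_vec k))\<^sup>2) * char k x"
proof -
  have 1: "partial_deriv i (\<lambda>x. c * char k x) = (\<lambda>x. (c * (2 * pi * of_int (k $ i)) * \<i>) * char k x)" for i c
    by (auto simp: partial_deriv_def frechet_derivative_char inner_axis)
  have 2: "partial_deriv i (char k) = (\<lambda>x. ((2 * pi * of_int (k $ i)) * \<i>) * char k x)" for i
    using 1[of i 1] by simp
  have "smooth_laplacian (char k) x = (\<Sum>i\<in>UNIV. - (4 * pi\<^sup>2 * (real_of_int (k $ i))\<^sup>2) * char k x)"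
    unfolding smooth_laplacian_def 2 1 by (intro sum.cong) (auto simp: power2_eq_square)
  also have "\<dots> = - of_real (4 * pi\<^sup>2 * (\<Sum>i\<in>UNIV. (real_of_int (k $ i))\<^sup>2)) * char k x"
    by (simp add: sum_distrib_left sum_distrib_right sum_negf)
  finally show ?thesis by (simp only: norm_lattice_vec)
qed

section \<open>Integration by parts against characters\<close>

lemma torus_smooth_differentiable:
  assumes "torus_smooth f" shows "(f has_derivative frechet_derivative f (at x)) (at x)"
  using assms frechet_derivative_works unfolding torus_smooth_def by (metis Ck.simps(2))

lemma torus_smooth_continuous: "torus_smooth f \<Longrightarrow> continuous_on UNIV f"
  unfolding torus_smooth_def by (metis Ck.simps(1))

lemma torus_smooth_periodic: "torus_smooth f \<Longrightarrow> \<forall>i. z $ i \<in> \<int> \<Longrightarrow> f (x + z) = f x"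
  unfolding torus_smooth_def by metis

lemma torus_smooth_partial_deriv:
  assumes "torus_smooth f" shows "torus_smooth (partial_deriv i f)"
  unfolding torus_smooth_def
proof (intro conjI allI impI)
  show "Ck k (partial_deriv i f)" for k
    using assms unfolding torus_smooth_def partial_deriv_def[abs_def] by (metis Ck.simps(2))
  fix x z :: "real^'a" assume z: "\<forall>i. z $ i \<in> \<int>"
  have "((\<lambda>y. f (y + z)) has_derivative frechet_derivative f (at (x + z))) (at x)"
  proof -
    have "((\<lambda>y. y + z) has_derivative (\<lambda>v. v)) (at x)" by (auto intro!: derivative_eq_intros)
    from has_derivative_compose[OF this torus_smooth_differentiable[OF assms, of "x + z"]]
    show ?thesis .
  qed
  then have "(f has_derivative frechet_derivative f (at (x + z))) (at x)"
    using torus_smooth_periodic[OF assms z] by simp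
  then have "frechet_derivative f (at (x + z)) = frechet_derivative f (at x)"
    by (rule frechet_derivative_at)
  then show "partial_deriv i f (x + z) = partial_deriv i f x" by (simp add: partial_deriv_def)
qed

text \<open>The product of \<open>f\<close> and the character is periodic, so its partial derivative
  has mean 0; the product rule then gives integration by parts without boundary terms.\<close>

lemma integral_partial_deriv_char:
  assumes "torus_smooth f"
  shows "(LINT x|torus. partial_deriv i f x * char k x) = - (2 * pi * of_int (k $ i) * \<i>) * (LINT x|torus. f x * char k x)"
proof -
  note c = torus_smooth_continuous[OF assms] torus_smooth_continuous[OF torus_smooth_partial_deriv[OF assms]]
  define g' where "g' x v = f x * ((2 * pi * (lattice_vec k \<bullet> v)) * \<i> * char k x) + frechet_derivative f (at x) v * char k x" for x v
  have 1: "((\<lambda>x. f x * char k x) has_derivative g' x) (at x)" for x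
    unfolding g'_def using has_derivative_char[of 1 k x]
    by (intro has_derivative_mult torus_smooth_differentiable assms) simp
  have 2: "g' x (axis i 1) = (2 * pi * of_int (k $ i) * \<i>) * (f x * char k x) + partial_deriv i f x * char k x" for x
    by (simp add: g'_def partial_deriv_def inner_axis)
  have "(LINT x|torus. g' x (axis i 1)) = 0"
  proof (rule integral_torus_partial_derivative_eq_0[OF 1])
    show "continuous_on UNIV (\<lambda>x. g' x (axis i 1))"
      unfolding 2 by (intro continuous_intros c)
    have "\<forall>j. (axis i 1 :: real^'a) $ j \<in> \<int>" by (auto simp: axis_def)
    then show "f (x + axis i 1) * char k (x + axis i 1) = f x * char k x" for x
      by (simp add: char_periodic torus_smooth_periodic[OF assms])
  qed
  also have "(LINT x|torus. g' x (axis i 1)) = (2 * pi * of_int (k $ i) * \<i>) * (LINT x|torus. f x * char k x) + (LINT x|torus. partial_deriv i f x * char k x)"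
    unfolding 2 by (subst Bochner_Integration.integral_add)
      (auto intro!: integrable_torus_continuous continuous_intros c)
  finally show ?thesis by (simp add: eq_neg_iff_add_eq_0 add.commute)
qed

text \<open>Integration by parts with the constant function 1 gives \<open>k $ i\<close> times the
  integral equal to 0, for a coordinate with \<open>k $ i \<noteq> 0\<close>.\<close>

lemma integral_char: "(LINT x|torus. char k x) = (if k = 0 then 1 else 0)"
proof (cases "k = 0")
  case True
  then show ?thesis by (simp)
next
  case False
  then obtain i where i: "k $ i \<noteq> 0" by (auto simp: vec_eq_iff)
  have s: "torus_smooth (\<lambda>x::real^'a. 1)" using torus_smooth_char[of 0] by (simp add: char_0[abs_def])
  have "partial_deriv i (\<lambda>x. 1) x = 0" for x by (simp add: partial_deriv_def)
  then show ?thesis using integral_partial_deriv_char[OF s, of i k] i False by simp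
qed

lemma integral_smooth_laplacian_char:
  assumes "torus_smooth f"
  shows "(LINT x|torus. char k x * smooth_laplacian f x) = - of_real (4 * pi\<^sup>2 * (norm (lattice_vec k))\<^sup>2) * (LINT x|torus. f x * char k x)"
proof -
  note s = torus_smooth_partial_deriv[OF torus_smooth_partial_deriv[OF assms]]
  have "(LINT x|torus. char k x * smooth_laplacian f x) = (LINT x|torus. (\<Sum>i\<in>UNIV. partial_deriv i (partial_deriv i f) x * char k x))"
    by (simp add: smooth_laplacian_def sum_distrib_left mult.commute)
  also have "\<dots> = (\<Sum>i\<in>UNIV. (LINT x|torus. partial_deriv i (partial_deriv i f) x * char k x))"
    by (intro Bochner_Integration.integral_sum integrable_torus_continuous continuous_intros torus_smooth_continuous s)
  also have "\<dots> = (\<Sum>i\<in>UNIV. - (4 * pi\<^sup>2 * (real_of_int (k $ i))\<^sup>2) * (LINT x|torus. f x * char k x))"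
  proof (rule sum.cong[OF refl])
    fix i :: 'a
    have "- (2 * pi * of_int (k $ i) * \<i>) * (- (2 * pi * of_int (k $ i) * \<i>) * J) = - (4 * pi\<^sup>2 * (real_of_int (k $ i))\<^sup>2) * J" for J :: complex
      by (simp add: power2_eq_square)
    then show "(LINT x|torus. partial_deriv i (partial_deriv i f) x * char k x) = - (4 * pi\<^sup>2 * (real_of_int (k $ i))\<^sup>2) * (LINT x|torus. f x * char k x)"
      unfolding integral_partial_deriv_char[OF torus_smooth_partial_deriv[OF assms]] integral_partial_deriv_char[OF assms] .
  qed
  also have "\<dots> = - of_real (4 * pi\<^sup>2 * (\<Sum>i\<in>UNIV. (real_of_int (k $ i))\<^sup>2)) * (LINT x|torus. f x * char k x)"
  proof -
    have "(\<Sum>i\<in>UNIV. - (4 * pi\<^sup>2 * (real_of_int (k $ i))\<^sup>2) * J) = - of_real (4 * pi\<^sup>2 * (\<Sum>i\<in>UNIV. (real_of_int (k $ i))\<^sup>2)) * J"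
      for J :: complex by (simp add: sum_distrib_left sum_distrib_right sum_negf)
    then show ?thesis .
  qed
  finally show ?thesis by (simp only: norm_lattice_vec)
qed

section \<open>Fourier coefficients of smooth functions and their decay\<close>

definition fourier_coeff :: "(real ^ 'n::finite \<Rightarrow> complex) \<Rightarrow> int ^ 'n \<Rightarrow> complex" where
  "fourier_coeff f k = (LINT x|torus. f x * char (- k) x)"

lemma fourier_coeff_bound:
  assumes "continuous_on UNIV f" obtains B where "B > 0" "\<And>k. cmod (fourier_coeff f k) \<le> B"
proof -
  obtain B where B: "B > 0" "\<And>x. x \<in> torus_cube \<Longrightarrow> norm (f x) \<le> B"
    using continuous_bounded_torus[OF assms] by metis
  have "cmod (fourier_coeff f k) \<le> B" for k
  proof -
    have "cmod (fourier_coeff f k) \<le> (LINT x|torus. cmod (f x * char (- k) x))"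
      unfolding fourier_coeff_def by (rule integral_norm_bound)
    also have "\<dots> \<le> (LINT x|(torus :: (real^'a) measure). B)"
      by (intro Bochner_Integration.integral_mono integrable_torus_continuous continuous_intros assms)
        (auto simp: norm_mult B)
    finally show ?thesis by simp
  qed
  then show ?thesis using that B by blast
qed

text \<open>Each power of \<open>k $ i\<close> is traded for one derivative of \<open>f\<close>, so
  the induction must range over all smooth \<open>f\<close>. The factor \<open>2 * pi\<close> gained
  each time is at least 1 and is dropped.\<close>

lemma fourier_coeff_decay:
  assumes "torus_smooth f"
  shows "\<exists>B>0. \<forall>k. \<bar>real_of_int (k $ i)\<bar> ^ p * cmod (fourier_coeff f k) \<le> B"
  using assms
proof (induction p arbitrary: f)
  case 0
  then show ?case using fourier_coeff_bound[OF torus_smooth_continuous] by (metis mult_1 power_0)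
next
  case (Suc p)
  obtain B where B: "B > 0" "\<And>k. \<bar>real_of_int (k $ i)\<bar> ^ p * cmod (fourier_coeff (partial_deriv i f) k) \<le> B"
    using Suc.IH[OF torus_smooth_partial_deriv[OF Suc.prems]] by blast
  have "\<bar>real_of_int (k $ i)\<bar> ^ Suc p * cmod (fourier_coeff f k) \<le> B" for k
  proof -
    have "cmod (fourier_coeff (partial_deriv i f) k) = 2 * pi * \<bar>real_of_int (k $ i)\<bar> * cmod (fourier_coeff f k)"
      unfolding fourier_coeff_def integral_partial_deriv_char[OF Suc.prems] by (simp add: norm_mult)
    moreover have "2 * pi * \<bar>real_of_int (k $ i)\<bar> * cmod (fourier_coeff f k) \<ge> 1 * \<bar>real_of_int (k $ i)\<bar> * cmod (fourier_coeff f k)"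
      using pi_ge_two by (intro mult_right_mono) auto
    ultimately have "\<bar>real_of_int (k $ i)\<bar> ^ p * (\<bar>real_of_int (k $ i)\<bar> * cmod (fourier_coeff f k)) \<le> \<bar>real_of_int (k $ i)\<bar> ^ p * cmod (fourier_coeff (partial_deriv i f) k)"
      by (intro mult_left_mono) auto
    also have "\<dots> \<le> B" by (rule B)
    finally show ?thesis by (simp add: ac_simps)
  qed
  then show ?case using B(1) by blast
qed

section \<open>Completeness of the characters\<close>

text \<open>This realises the torus as a compact subset of a Euclidean space, where real polynomials
  are uniformly dense in the continuous functions. Pulled back, such polynomials become
  trigonometric polynomials.\<close>

definition torus_embed :: "real ^ 'n::finite \<Rightarrow> complex ^ 'n" where
  "torus_embed x = (\<chi> i. cis (2 * pi * (x $ i)))"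

lemma continuous_on_torus_embed [continuous_intros]: "continuous_on S torus_embed"
  unfolding torus_embed_def by (intro continuous_intros continuous_on_component continuous_on_id)

lemma cis_2pi_eq_iff: "cis (2 * pi * a) = cis (2 * pi * b) \<longleftrightarrow> a - b \<in> \<int>"
proof -
  have "cis (2 * pi * a) = cis (2 * pi * b) \<longleftrightarrow> cis (2 * pi * a) / cis (2 * pi * b) = 1" by simp
  also have "\<dots> \<longleftrightarrow> cis (2 * pi * (a - b)) = 1" by (simp add: cis_divide algebra_simps)
  also have "\<dots> \<longleftrightarrow> (\<exists>n. a - b = of_int n)" by (auto simp: cis_conv_exp exp_eq_1)
  finally show ?thesis by (auto elim: Ints_cases)
qed

lemma char_axis: "char (axis i m) x = cis (2 * pi * (real_of_int m * x $ i))"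
proof -
  have "lattice_vec (axis i m) = axis i (real_of_int m)" by (auto simp: vec_eq_iff axis_def)
  then show ?thesis by (simp add: char_def inner_axis')
qed

definition trig_poly :: "(real ^ 'n::finite \<Rightarrow> complex) \<Rightarrow> bool" where
  "trig_poly f \<longleftrightarrow> (\<exists>F c. finite F \<and> f = (\<lambda>x. \<Sum>k\<in>F. c k * char k x))"

lemma trig_poly_char: "trig_poly (\<lambda>x. c * char k x)"
  unfolding trig_poly_def by (rule exI[of _ "{k}"], rule exI[of _ "\<lambda>_. c"]) simp

lemma trig_poly_const: "trig_poly (\<lambda>x. c)"
  using trig_poly_char[of c 0] by simp

lemma trig_poly_add:
  assumes "trig_poly f" "trig_poly g" shows "trig_poly (\<lambda>x. f x + g x)"
proof -
  obtain F c G d where F: "finite F" "f = (\<lambda>x. \<Sum>k\<in>F. c k * char k x)"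
    and G: "finite G" "g = (\<lambda>x. \<Sum>k\<in>G. d k * char k x)"
    using assms unfolding trig_poly_def by blast
  have "f x = (\<Sum>k\<in>F \<union> G. (if k \<in> F then c k else 0) * char k x)" for x
    unfolding F(2) by (rule sum.mono_neutral_cong_left) (use F G in auto)
  moreover have "g x = (\<Sum>k\<in>F \<union> G. (if k \<in> G then d k else 0) * char k x)" for x
    unfolding G(2) by (rule sum.mono_neutral_cong_left) (use F G in auto)
  ultimately have "f x + g x = (\<Sum>k\<in>F \<union> G. ((if k \<in> F then c k else 0) + (if k \<in> G then d k else 0)) * char k x)" for x
    by (simp only: sum.distrib ring_distribs)
  then have "(\<lambda>x. f x + g x) = (\<lambda>x. \<Sum>k\<in>F \<union> G. ((if k \<in> F then c k else 0) + (if k \<in> G then d k else 0)) * char k x)" by (rule ext)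
  then show ?thesis unfolding trig_poly_def using F(1) G(1) 
    by (intro exI[of _ "F \<union> G"] exI[of _ "\<lambda>k. (if k \<in> F then c k else 0) + (if k \<in> G then d k else 0)"]) simp
qed

lemma trig_poly_sum:
  assumes "finite A" "\<And>i. i \<in> A \<Longrightarrow> trig_poly (f i)" shows "trig_poly (\<lambda>x. \<Sum>i\<in>A. f i x)"
  using assms by (induction A rule: finite_induct) (auto intro: trig_poly_const trig_poly_add)

lemma trig_poly_mult:
  assumes "trig_poly f" "trig_poly g" shows "trig_poly (\<lambda>x. f x * g x)"
proof -
  obtain F c G d where F: "finite F" "f = (\<lambda>x. \<Sum>k\<in>F. c k * char k x)"
    and G: "finite G" "g = (\<lambda>x. \<Sum>k\<in>G. d k * char k x)"
    using assms unfolding trig_poly_def by blast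
  have "(\<lambda>x. f x * g x) = (\<lambda>x. \<Sum>k\<in>F. \<Sum>l\<in>G. (c k * d l) * char (k + l) x)"
    by (simp add: F(2) G(2) sum_product char_add mult_ac)
  moreover have "trig_poly (\<lambda>x. \<Sum>k\<in>F. \<Sum>l\<in>G. (c k * d l) * char (k + l) x)"
    by (intro trig_poly_sum trig_poly_char F G)
  ultimately show ?thesis by simp
qed

text \<open>A real-linear functional on \<open>complex ^ 'n\<close> combines real and imaginary
  parts of the coordinates. Pulled back these are cosines and sines, hence combinations of the
  characters with frequencies \<open>axis i 1\<close> and \<open>axis i (-1)\<close>. This is the
  base case for all real polynomials.\<close>

lemma trig_poly_linear:
  fixes L :: "complex ^ 'n::finite \<Rightarrow> real"
  assumes "bounded_linear L" shows "trig_poly (\<lambda>x. of_real (L (torus_embed x)))"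
proof -
  interpret L: bounded_linear L by fact
  have "of_real (L (torus_embed x)) = (\<Sum>i\<in>UNIV. ((of_real (L (axis i 1)) - \<i> * of_real (L (axis i \<i>))) / 2) * char (axis i 1) x
      + ((of_real (L (axis i 1)) + \<i> * of_real (L (axis i \<i>))) / 2) * char (axis i (-1)) x)" for x
  proof -
    have "torus_embed x = (\<Sum>i\<in>UNIV. cos (2 * pi * x $ i) *\<^sub>R axis i 1 + sin (2 * pi * x $ i) *\<^sub>R axis i \<i>)"
      by (auto simp: vec_eq_iff torus_embed_def axis_def sum.distrib if_distrib[of "\<lambda>a. _ *\<^sub>R a"] sum.delta' complex_eq_iff cong: if_cong)
    then have "L (torus_embed x) = (\<Sum>i\<in>UNIV. cos (2 * pi * x $ i) * L (axis i 1) + sin (2 * pi * x $ i) * L (axis i \<i>))"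
      by (simp add: L.sum L.add L.scaleR)
    then have "complex_of_real (L (torus_embed x)) = (\<Sum>i\<in>UNIV. of_real (cos (2 * pi * x $ i) * L (axis i 1) + sin (2 * pi * x $ i) * L (axis i \<i>)))"
      by simp
    also have "\<dots> = (\<Sum>i\<in>UNIV. ((of_real (L (axis i 1)) - \<i> * of_real (L (axis i \<i>))) / 2) * char (axis i 1) x
      + ((of_real (L (axis i 1)) + \<i> * of_real (L (axis i \<i>))) / 2) * char (axis i (-1)) x)"
      by (intro sum.cong refl) (simp add: char_axis complex_eq_iff field_simps)
    finally show ?thesis .
  qed
  then have "(\<lambda>x. of_real (L (torus_embed x))) = (\<lambda>x. \<Sum>i\<in>UNIV. ((of_real (L (axis i 1)) - \<i> * of_real (L (axis i \<i>))) / 2) * char (axis i 1) x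
      + ((of_real (L (axis i 1)) + \<i> * of_real (L (axis i \<i>))) / 2) * char (axis i (-1)) x)" by (rule ext)
  moreover have "trig_poly \<dots>" by (intro trig_poly_sum trig_poly_add trig_poly_char finite)
  ultimately show ?thesis by simp
qed

lemma trig_poly_polynomial:
  fixes p :: "complex ^ 'n::finite \<Rightarrow> real"
  assumes "real_polynomial_function p" shows "trig_poly (\<lambda>x. of_real (p (torus_embed x)))"
  using assms
  by (induction rule: real_polynomial_function.induct)
    (auto simp: trig_poly_linear trig_poly_const trig_poly_add trig_poly_mult)

lemma integral_trig_poly_eq_0:
  assumes "integrable torus f" "\<And>k. fourier_coeff f k = 0" "trig_poly g"
  shows "(LINT x|torus. f x * g x) = 0"
proof -
  obtain F c where F: "finite F" "g = (\<lambda>x. \<Sum>k\<in>F. c k * char k x)"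
    using assms(3) unfolding trig_poly_def by blast
  have "(LINT x|torus. f x * g x) = (LINT x|torus. (\<Sum>k\<in>F. c k * (f x * char k x)))"
    by (simp add: F(2) sum_distrib_left mult_ac)
  also have "\<dots> = (\<Sum>k\<in>F. LINT x|torus. c k * (f x * char k x))"
    by (intro Bochner_Integration.integral_sum integrable_mult_right integrable_torus_mult_continuous
        assms continuous_intros)
  also have "\<dots> = (\<Sum>k\<in>F. c k * fourier_coeff f (- k))"
    by (simp add: fourier_coeff_def)
  finally show ?thesis by (simp add: assms(2))
qed

text \<open>On the compact image \<open>g\<close> is uniformly close to a polynomial, whose pullback
  is orthogonal to \<open>f\<close>. The error is at most \<open>e\<close> times the L1 norm
  \<open>J\<close> of \<open>f\<close>.\<close>

lemma integral_continuous_embed_eq_0: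
  fixes f :: "real ^ 'n::finite \<Rightarrow> complex" and g :: "complex ^ 'n \<Rightarrow> real"
  assumes f: "integrable torus f" "\<And>k. fourier_coeff f k = 0" and g: "continuous_on UNIV g"
  shows "(LINT x|torus. f x * of_real (g (torus_embed x))) = 0"
proof -
  define X where "X = torus_embed ` cbox 0 (1 :: real^'n)"
  have X: "compact X" unfolding X_def
    by (rule compact_continuous_image) (auto intro: continuous_intros)
  have gc: "continuous_on UNIV (\<lambda>x. complex_of_real (g (torus_embed x)))"
    by (intro continuous_intros continuous_on_compose2[OF g]) auto
  define J where "J = (LINT x|torus. cmod (f x))"
  have "J \<ge> 0" by (simp add: J_def)
  have "cmod (LINT x|torus. f x * of_real (g (torus_embed x))) \<le> e * J" if e: "e > 0" for e
  proof -
    obtain p where p: "real_polynomial_function p" "\<And>z. z \<in> X \<Longrightarrow> \<bar>g z - p z\<bar> < e"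
      using Stone_Weierstrass_real_polynomial_function[OF X continuous_on_subset[OF g] e] by blast
    have pcont: "continuous_on UNIV p" using p(1) by (intro continuous_on_polymonial_function) (simp add: real_polynomial_function_eq)
    have pc: "continuous_on UNIV (\<lambda>x. complex_of_real (p (torus_embed x)))"
      by (intro continuous_intros continuous_on_compose2[OF pcont]) auto
    note i = integrable_torus_mult_continuous[OF f(1) gc] integrable_torus_mult_continuous[OF f(1) pc]
    have "(LINT x|torus. f x * of_real (g (torus_embed x))) = (LINT x|torus. f x * of_real (g (torus_embed x))) - (LINT x|torus. f x * of_real (p (torus_embed x)))"
      using integral_trig_poly_eq_0[OF f trig_poly_polynomial[OF p(1)]] by simp
    also have "\<dots> = (LINT x|torus. f x * of_real (g (torus_embed x)) - f x * of_real (p (torus_embed x)))"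
      by (rule Bochner_Integration.integral_diff[OF i, symmetric])
    also have "cmod \<dots> \<le> (LINT x|torus. cmod (f x * of_real (g (torus_embed x)) - f x * of_real (p (torus_embed x))))"
      by (rule integral_norm_bound)
    also have "\<dots> \<le> (LINT x|torus. e * cmod (f x))"
    proof (rule Bochner_Integration.integral_mono)
      fix x :: "real^'n" assume "x \<in> space torus"
      then have "torus_embed x \<in> X" using torus_cube_subset_cbox by (auto simp: X_def)
      then have "\<bar>g (torus_embed x) - p (torus_embed x)\<bar> * cmod (f x) \<le> e * cmod (f x)"
        using p(2) by (intro mult_right_mono) (auto intro: less_imp_le)
      moreover have "cmod (f x * of_real (g (torus_embed x)) - f x * of_real (p (torus_embed x))) = \<bar>g (torus_embed x) - p (torus_embed x)\<bar> * cmod (f x)"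
        by (simp flip: right_diff_distrib of_real_diff add: norm_mult)
      ultimately show "cmod (f x * of_real (g (torus_embed x)) - f x * of_real (p (torus_embed x))) \<le> e * cmod (f x)" by simp
    qed (use f(1) i in \<open>auto intro!: integrable_norm Bochner_Integration.integrable_diff\<close>)
    also have "\<dots> = e * J" by (simp add: J_def)
    finally show ?thesis .
  qed note * = this
  have "cmod (LINT x|torus. f x * of_real (g (torus_embed x))) \<le> e" if "e > 0" for e
  proof -
    \<comment> \<open>The denominator is \<open>J + 1\<close> because \<open>J\<close> may be
      0.\<close>
    have "cmod (LINT x|torus. f x * of_real (g (torus_embed x))) \<le> (e / (J + 1)) * J"
      using \<open>J \<ge> 0\<close> that by (intro *) simp
    also have "\<dots> \<le> e" using \<open>J \<ge> 0\<close> that by (simp add: field_simps)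
    finally show ?thesis .
  qed
  then have "cmod (LINT x|torus. f x * of_real (g (torus_embed x))) \<le> 0"
    by (rule field_le_epsilon[of _ 0, simplified])
  then show ?thesis by simp
qed

text \<open>
  The indicator function of \<open>U\<close> is the pointwise limit of truncated multiples of the distance of
  \<open>torus_embed x\<close> to the compact image of the complement of \<open>U\<close>.
\<close>

lemma integral_open_eq_0:
  fixes f :: "real ^ 'n::finite \<Rightarrow> complex"
  assumes f: "integrable torus f" "\<And>k. fourier_coeff f k = 0" and U: "open U" "U \<subseteq> box 0 1"
  shows "(LINT x|torus. indicator U x *\<^sub>R f x) = 0"
proof -
  define C where "C = torus_embed ` (cbox 0 1 - U)"
  have "compact (cbox 0 1 - U)" using U by (simp add: compact_diff)
  then have C: "closed C" unfolding C_def
    by (intro compact_imp_closed compact_continuous_image) (auto intro: continuous_intros)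
  \<comment> \<open>Nonemptiness matters: \<open>infdist\<close> to the empty set is 0, not a
    positive distance.\<close>
  have "(0 :: real^'n) \<in> cbox 0 1 - U" using U(2) by (auto simp: mem_box_cart)
  then have Cne: "C \<noteq> {}" by (auto simp: C_def)
  \<comment> \<open>On the closed cube the embedding identifies opposite faces only. As
    \<open>U\<close> lies in the open box, a point of \<open>U\<close> differs from any other point
    of the closed cube by less than 1 in every coordinate, so an integral difference must
    vanish.\<close>
  have mem: "torus_embed x \<in> C \<longleftrightarrow> x \<notin> U" if x: "x \<in> torus_cube" for x
  proof
    assume "x \<notin> U" then show "torus_embed x \<in> C" using x torus_cube_subset_cbox by (auto simp: C_def)
  next
    assume "torus_embed x \<in> C"
    then obtain y where y: "torus_embed x = torus_embed y" "y \<in> cbox 0 1" "y \<notin> U" by (auto simp: C_def)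
    show "x \<notin> U"
    proof
      assume xU: "x \<in> U"
      have "x $ i = y $ i" for i
      proof -
        have "x $ i - y $ i \<in> \<int>" using y(1) by (simp add: torus_embed_def vec_eq_iff cis_2pi_eq_iff)
        then obtain n where n: "x $ i - y $ i = of_int n" by (elim Ints_cases)
        have "0 < x $ i" "x $ i < 1" using xU U(2) by (auto simp: subset_iff mem_box_cart)
        moreover have "0 \<le> y $ i" "y $ i \<le> 1" using y(2) by (auto simp: mem_box_cart)
        ultimately have "\<bar>real_of_int n\<bar> < 1" using n by linarith
        then have "n = 0" by linarith
        then show ?thesis using n by simp
      qed
      then have "x = y" by (simp add: vec_eq_iff)
      then show False using xU y(3) by simp
    qed
  qed
  define g where "g m z = min 1 (real m * infdist z C)" for m z
  have g: "continuous_on UNIV (g m)" for m unfolding g_def by (intro continuous_intros)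
  have gm: "(\<lambda>x. complex_of_real (g m (torus_embed x))) \<in> borel_measurable torus" for m
    by (intro borel_measurable_torusI borel_measurable_continuous_onI continuous_intros continuous_on_compose2[OF g]) auto
  have lim: "(\<lambda>m. g m (torus_embed x)) \<longlonglongrightarrow> indicator U x" if x: "x \<in> torus_cube" for x
  proof (cases "x \<in> U")
    case False
    then show ?thesis using mem[OF x] by (simp add: g_def)
  next
    case True
    then have "torus_embed x \<notin> C" using mem[OF x] by simp
    then have pos: "infdist (torus_embed x) C > 0" using C Cne infdist_pos_not_in_closed by blast
    obtain M where M: "1 < real M * infdist (torus_embed x) C" using reals_Archimedean3[OF pos] by blast
    have "\<forall>\<^sub>F m in sequentially. g m (torus_embed x) = 1"
    proof (rule eventually_sequentiallyI[of M])
      fix m assume "M \<le> m"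
      then have "real M * infdist (torus_embed x) C \<le> real m * infdist (torus_embed x) C"
        using pos by (intro mult_right_mono) auto
      then show "g m (torus_embed x) = 1" using M by (simp add: g_def)
    qed
    then show ?thesis using True by (auto intro: tendsto_eventually)
  qed
  have "(\<lambda>m. LINT x|torus. f x * of_real (g m (torus_embed x))) \<longlonglongrightarrow> (LINT x|torus. indicator U x *\<^sub>R f x)"
  proof (rule integral_dominated_convergence[where w = "\<lambda>x. cmod (f x)"])
    have [measurable]: "U \<in> sets borel" using U(1) by (rule borel_open)
    have Ut: "indicat_real U \<in> borel_measurable torus" by (intro borel_measurable_torusI) measurable
    show "(\<lambda>x. indicator U x *\<^sub>R f x) \<in> borel_measurable torus"
      using f(1) Ut by (intro borel_measurable_scaleR) auto
    show "(\<lambda>x. f x * of_real (g m (torus_embed x))) \<in> borel_measurable torus" for m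
      using f(1) gm by (intro borel_measurable_times) auto
    show "integrable torus (\<lambda>x. cmod (f x))" using f(1) by simp
    show "AE x in torus. (\<lambda>m. f x * of_real (g m (torus_embed x))) \<longlonglongrightarrow> indicator U x *\<^sub>R f x"
    proof (rule AE_I2)
      fix x :: "real^'n" assume "x \<in> space torus"
      then have "(\<lambda>m. f x * of_real (g m (torus_embed x))) \<longlonglongrightarrow> f x * of_real (indicator U x)"
        by (intro tendsto_intros lim) simp
      then show "(\<lambda>m. f x * of_real (g m (torus_embed x))) \<longlonglongrightarrow> indicator U x *\<^sub>R f x"
        by (simp add: scaleR_conv_of_real mult.commute)
    qed
    show "AE x in torus. norm (f x * of_real (g m (torus_embed x))) \<le> cmod (f x)" for m
    proof (rule AE_I2)
      fix x
      have "\<bar>g m (torus_embed x)\<bar> \<le> 1" by (simp add: g_def infdist_nonneg)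
      then have "cmod (f x) * \<bar>g m (torus_embed x)\<bar> \<le> cmod (f x) * 1" by (intro mult_left_mono) auto
      then show "norm (f x * of_real (g m (torus_embed x))) \<le> cmod (f x)" by (simp add: norm_mult)
    qed
  qed
  moreover have "(LINT x|torus. f x * of_real (g m (torus_embed x))) = 0" for m
    by (rule integral_continuous_embed_eq_0[OF f g])
  ultimately show ?thesis by (simp add: LIMSEQ_const_iff)
qed

text \<open>The integral of \<open>f\<close> vanishes over open sets, and these form an
  intersection-stable generator of the Borel sets. Dynkin induction extends this to all Borel sets,
  which forces \<open>f\<close> to vanish almost everywhere.\<close>

lemma fourier_coeff_eq_0_imp_AE_eq_0:
  fixes f :: "real ^ 'n::finite \<Rightarrow> complex"
  assumes f: "integrable torus f" "\<And>k. fourier_coeff f k = 0"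
  shows "AE x in torus. f x = 0"
proof -
  define G where "G = {U :: (real^'n) set. open U}"
  \<comment> \<open>The faces of the cube are null, so an arbitrary open set may be cut down to the
    open box required by \<open>integral_open_eq_0\<close>.\<close>
  have ae_box: "AE x in torus. x \<in> box 0 (1 :: real^'n)"
  proof -
    have "emeasure lborel (cbox 0 1 - box 0 (1 :: real^'n)) = 0"
    proof -
      have "emeasure lborel (box 0 (1 :: real^'n)) = emeasure lborel (cbox 0 (1 :: real^'n))"
        by (simp add: emeasure_lborel_box_eq emeasure_lborel_cbox_eq)
      then show ?thesis
        by (subst emeasure_Diff) (auto simp: emeasure_lborel_cbox_eq box_subset_cbox top_unique)
    qed
    then have "AE x in lborel. x \<notin> cbox 0 1 - box 0 (1 :: real^'n)"
      by (intro AE_not_in) (auto simp: null_sets_def)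
    then have "AE x in lborel. x \<in> torus_cube \<longrightarrow> x \<in> box 0 (1 :: real^'n)"
      by eventually_elim (use torus_cube_subset_cbox in auto)
    then show ?thesis unfolding torus_eq by (subst AE_restrict_space_iff) auto
  qed
  have op: "(LINT x|torus. indicator U x *\<^sub>R f x) = 0" if "open U" for U
  proof -
    have "(LINT x|torus. indicator U x *\<^sub>R f x) = (LINT x|torus. indicator (U \<inter> box 0 1) x *\<^sub>R f x)"
    proof (rule integral_cong_AE)
      have [measurable]: "U \<in> sets borel" "box 0 (1::real^'n) \<in> sets borel" using that by auto
      have "indicat_real U \<in> borel_measurable torus" "indicat_real (U \<inter> box 0 1) \<in> borel_measurable torus"
        by (intro borel_measurable_torusI; measurable)+
      then show "(\<lambda>x. indicator U x *\<^sub>R f x) \<in> borel_measurable torus"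
        "(\<lambda>x. indicator (U \<inter> box 0 1) x *\<^sub>R f x) \<in> borel_measurable torus"
        using f(1) by auto
      show "AE x in torus. indicator U x *\<^sub>R f x = indicator (U \<inter> box 0 1) x *\<^sub>R f x"
        using ae_box by eventually_elim (simp add: indicator_def)
    qed
    also have "\<dots> = 0" using that by (intro integral_open_eq_0 f) auto
    finally show ?thesis .
  qed
  have int: "integrable torus (\<lambda>x. indicator A x *\<^sub>R f x)" if "A \<in> sets borel" for A
    using f(1)
  proof (rule Bochner_Integration.integrable_bound)
    have "indicat_real A \<in> borel_measurable torus" 
      by (intro borel_measurable_torusI borel_measurable_indicator that)
    then show "(\<lambda>x. indicator A x *\<^sub>R f x) \<in> borel_measurable torus" using f(1) by auto
  qed (auto simp: indicator_def)
  have all: "(LINT x|torus. indicator A x *\<^sub>R f x) = 0" if "A \<in> sets borel" for A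
  proof -
    have "Int_stable G" by (auto simp: Int_stable_def G_def)
    moreover have "G \<subseteq> Pow UNIV" by simp
    moreover have "A \<in> sigma_sets UNIV G" using that by (simp add: borel_def G_def)
    ultimately show ?thesis
    proof (induction rule: sigma_sets_induct_disjoint)
      case (basic A)
      then show ?case by (simp add: op G_def)
    next
      case empty
      then show ?case by simp
    next
      case (compl A)
      then have A: "A \<in> sets borel" by (simp add: borel_def G_def)
      have "(LINT x|torus. indicator (UNIV - A) x *\<^sub>R f x) = (LINT x|torus. f x - indicator A x *\<^sub>R f x)"
        by (rule Bochner_Integration.integral_cong) (auto simp: indicator_def)
      also have "\<dots> = (LINT x|torus. f x) - (LINT x|torus. indicator A x *\<^sub>R f x)"
        by (rule Bochner_Integration.integral_diff[OF f(1) int[OF A]])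
      also have "(LINT x|torus. f x) = 0" using op[of UNIV] by simp
      finally show ?case using compl by simp
    next
      case (union A)
      then have A: "A i \<in> sets borel" for i by (auto simp: borel_def G_def)
      define B where "B i = torus_cube \<inter> A i" for i
      have B: "B i \<in> sets torus" for i
        using A unfolding torus_eq by (auto simp: B_def sets_restrict_space)
      have AB: "(LINT x|torus. indicator (A i) x *\<^sub>R f x) = (LINT x:B i|torus. f x)" for i
        unfolding set_lebesgue_integral_def
        by (rule Bochner_Integration.integral_cong) (auto simp: B_def indicator_def)
      have "integrable torus (\<lambda>x. indicator (\<Union>i. A i) x *\<^sub>R f x)" using A by (intro int) auto
      also have "?this \<longleftrightarrow> integrable torus (\<lambda>x. indicator (\<Union>i. B i) x *\<^sub>R f x)"
        by (rule Bochner_Integration.integrable_cong) (auto simp: B_def indicator_def)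
      finally have iB: "set_integrable torus (\<Union>i. B i) f" unfolding set_integrable_def .
      have "(LINT x|torus. indicator (\<Union>i. A i) x *\<^sub>R f x) = (LINT x:(\<Union>i. B i)|torus. f x)"
        unfolding set_lebesgue_integral_def
        by (rule Bochner_Integration.integral_cong) (auto simp: B_def indicator_def)
      also have "\<dots> = (\<Sum>i. (LINT x:B i|torus. f x))"
        using union(1) by (intro lebesgue_integral_countable_add B iB) (auto simp: B_def disjoint_family_on_def)
      also have "\<dots> = 0" using union(3) by (simp flip: AB)
      finally show ?case .
    qed
  qed
  show ?thesis
  proof (rule torus.density_zero[OF f(1)])
    fix A assume "A \<in> sets (torus :: (real^'n) measure)"
    then obtain B where B: "B \<in> sets borel" "A = torus_cube \<inter> B"
      unfolding torus_eq by (auto simp: sets_restrict_space)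
    then show "set_lebesgue_integral torus A f = 0"
      unfolding set_lebesgue_integral_def using all[of A] by auto
  qed
qed

section \<open>Lattice points in spherical shells\<close>

lemma int_box_eq_image: "{y :: int ^ 'n::finite. \<forall>j. y $ j \<in> A j} = vec_lambda ` (Pi\<^sub>E UNIV A)"
proof (intro set_eqI iffI)
  fix y :: "int ^ 'n" assume "y \<in> {y. \<forall>j. y $ j \<in> A j}"
  then have "vec_nth y \<in> Pi\<^sub>E UNIV A" by auto
  then have "vec_lambda (vec_nth y) \<in> vec_lambda ` (Pi\<^sub>E UNIV A)" by (rule imageI)
  then show "y \<in> vec_lambda ` (Pi\<^sub>E UNIV A)" by simp
qed auto

lemma card_int_box: "card {y :: int ^ 'n::finite. \<forall>j. y $ j \<in> A j} = (\<Prod>j\<in>UNIV. card (A j))"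
proof -
  have "inj_on (vec_lambda :: ('n \<Rightarrow> int) \<Rightarrow> _) (Pi\<^sub>E UNIV A)"
    by (rule inj_onI) (simp add: vec_lambda_inject)
  then show ?thesis unfolding int_box_eq_image by (simp add: card_image card_PiE)
qed

lemma finite_int_box: "(\<And>j. finite (A j)) \<Longrightarrow> finite {y :: int ^ 'n::finite. \<forall>j. y $ j \<in> A j}"
  unfolding int_box_eq_image by (intro finite_imageI finite_PiE) auto

lemma abs_nth_le_floor_norm:
  assumes "norm (lattice_vec k) \<le> L" shows "\<bar>k $ i\<bar> \<le> \<lfloor>L\<rfloor>"
proof -
  have "\<bar>real_of_int (k $ i)\<bar> \<le> L"
    using component_le_norm_cart[of "lattice_vec k" i] assms by simp
  then show ?thesis by (simp add: le_floor_iff)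
qed

lemma lattice_ball_subset:
  "{k. norm (lattice_vec k) \<le> L} \<subseteq> {k :: int ^ 'n::finite. \<forall>j. k $ j \<in> {- \<lfloor>L\<rfloor>..\<lfloor>L\<rfloor>}}"
  using abs_nth_le_floor_norm by (auto simp: abs_le_iff minus_le_iff)

lemma finite_lattice_ball: "finite {k :: int ^ 'n::finite. norm (lattice_vec k) \<le> L}"
  by (rule finite_subset[OF lattice_ball_subset finite_int_box]) simp

lemma card_symmetric_int_interval: "L \<ge> 0 \<Longrightarrow> real (card {- \<lfloor>L\<rfloor>..\<lfloor>L\<rfloor>}) \<le> 2 * L + 1"
  by simp

lemma card_lattice_ball_le:
  assumes "L \<ge> 0"
  shows "real (card {k :: int ^ 'n::finite. norm (lattice_vec k) \<le> L}) \<le> (2 * L + 1) ^ CARD('n)"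
proof -
  have "card {k :: int ^ 'n. norm (lattice_vec k) \<le> L} \<le> card {k :: int ^ 'n. \<forall>j. k $ j \<in> {- \<lfloor>L\<rfloor>..\<lfloor>L\<rfloor>}}"
    by (rule card_mono[OF finite_int_box lattice_ball_subset]) simp
  also have "\<dots> = card {- \<lfloor>L\<rfloor>..\<lfloor>L\<rfloor>} ^ CARD('n)"
    by (subst card_int_box) simp
  finally have "real (card {k :: int ^ 'n. norm (lattice_vec k) \<le> L}) \<le> real (card {- \<lfloor>L\<rfloor>..\<lfloor>L\<rfloor>}) ^ CARD('n)"
    by (metis of_nat_le_iff of_nat_power)
  also have "\<dots> \<le> (2 * L + 1) ^ CARD('n)"
    using card_symmetric_int_interval[OF assms] by (intro power_mono) auto
  finally show ?thesis .
qed

text \<open>The tolerance on the squared norm grows like \<open>R\<close>, which means bounded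
  thickness in the norm: the difference of squares has the factor \<open>norm + R\<close>, at least
  \<open>R\<close>. The eigenvalue condition translates exactly into this form.\<close>

definition shell :: "real \<Rightarrow> real \<Rightarrow> (int ^ 'n::finite) set" where
  "shell c R = {k. \<bar>(norm (lattice_vec k))\<^sup>2 - R\<^sup>2\<bar> \<le> c * R}"

text \<open>Membership in the shell depends only on the norm, so \<open>k + m\<close> lies in it as
  well. Equality of the norms is an affine hyperplane condition on \<open>k\<close> when
  \<open>m \<noteq> 0\<close>.\<close>

definition shell_slice :: "real \<Rightarrow> real \<Rightarrow> int ^ 'n::finite \<Rightarrow> (int ^ 'n) set" where
  "shell_slice c R m = {k \<in> shell c R. norm (lattice_vec (k + m)) = norm (lattice_vec k)}"

lemma shell_subset_ball:
  assumes "c > 0" "R > 0" shows "shell c R \<subseteq> {k. norm (lattice_vec k) \<le> R + c}"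
proof
  fix k :: "int ^ 'n" assume "k \<in> shell c R"
  then have "(norm (lattice_vec k))\<^sup>2 \<le> R\<^sup>2 + c * R" by (auto simp: shell_def abs_le_iff)
  also have "\<dots> \<le> (R + c)\<^sup>2" using assms by (simp add: power2_eq_square algebra_simps)
  finally have "norm (lattice_vec k) \<le> R + c" by (rule power2_le_imp_le) (use assms in simp)
  then show "k \<in> {k. norm (lattice_vec k) \<le> R + c}" by simp
qed

lemma finite_shell: "c > 0 \<Longrightarrow> R > 0 \<Longrightarrow> finite (shell c R)"
  by (rule finite_subset[OF shell_subset_ball finite_lattice_ball])

text \<open>A point is encoded by its coordinates other than \<open>i\<close> and \<open>t\<close>
  together with \<open>k $ t mod (D + 1)\<close>. Inside a fibre the \<open>t\<close>-th coordinates
  differ by at most \<open>D\<close>, so the residue determines them, with no base point to choose;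
  the \<open>i\<close>-th coordinate then follows from the hyperplane equation, since
  \<open>m $ i \<noteq> 0\<close>.\<close>

lemma card_slice_fibre_le:
  fixes m :: "int ^ 'n::finite" and S :: "(int ^ 'n) set"
  assumes mi: "m $ i \<noteq> 0" and ti: "t \<noteq> i" and D: "D \<ge> 0" and L: "L \<ge> 0"
    and ball: "\<And>k. k \<in> S \<Longrightarrow> norm (lattice_vec k) \<le> L"
    and hyper: "\<And>k l. k \<in> S \<Longrightarrow> l \<in> S \<Longrightarrow> (\<Sum>j\<in>UNIV. m $ j * (k $ j - l $ j)) = 0"
    and close: "\<And>k l. k \<in> S \<Longrightarrow> l \<in> S \<Longrightarrow> (\<And>j. j \<noteq> i \<Longrightarrow> j \<noteq> t \<Longrightarrow> k $ j = l $ j) \<Longrightarrow> \<bar>k $ t - l $ t\<bar> \<le> D"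
  shows "real (card S) \<le> (of_int D + 1) * (2 * L + 1) ^ (CARD('n) - 2)"
proof -
  define \<Phi> where "\<Phi> k = (\<chi> j. if j = i then 0 else if j = t then k $ t mod (D + 1) else k $ j)" for k :: "int ^ 'n"
  define A where "A j = (if j = i then {0} else if j = t then {0..D} else {- \<lfloor>L\<rfloor>..\<lfloor>L\<rfloor>})" for j
  have "inj_on \<Phi> S"
  proof (rule inj_onI)
    fix k l assume kl: "k \<in> S" "l \<in> S" and eq: "\<Phi> k = \<Phi> l"
    then have e: "\<Phi> k $ j = \<Phi> l $ j" for j by simp
    have off: "k $ j = l $ j" if "j \<noteq> i" "j \<noteq> t" for j using e[of j] that by (simp add: \<Phi>_def)
    have "k $ t mod (D + 1) = l $ t mod (D + 1)" using e[of t] ti by (simp add: \<Phi>_def)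
    then have "(D + 1) dvd (k $ t - l $ t)" by (simp add: mod_eq_dvd_iff)
    moreover have "\<bar>k $ t - l $ t\<bar> < D + 1" using close[OF kl off] by simp
    ultimately have t: "k $ t = l $ t" using zdvd_imp_le[of "D + 1" "\<bar>k $ t - l $ t\<bar>"] by (cases "k $ t = l $ t") auto
    have "(\<Sum>j\<in>UNIV. m $ j * (k $ j - l $ j)) = (\<Sum>j\<in>{i}. m $ j * (k $ j - l $ j))"
      by (rule sum.mono_neutral_right) (use off t in auto)
    then have "k $ i = l $ i" using hyper[OF kl] mi by simp
    then show "k = l" using off t by (metis vec_eq_iff)
  qed
  then have "card S = card (\<Phi> ` S)" by (simp add: card_image)
  also have "\<dots> \<le> card {y. \<forall>j. y $ j \<in> A j}"
  proof (rule card_mono[OF finite_int_box])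
    show "\<Phi> ` S \<subseteq> {y. \<forall>j. y $ j \<in> A j}"
    proof clarsimp
      fix k j assume "k \<in> S"
      then have "\<bar>k $ j\<bar> \<le> \<lfloor>L\<rfloor>" by (intro abs_nth_le_floor_norm ball)
      then show "\<Phi> k $ j \<in> A j" 
        using D pos_mod_bound[of "D + 1" "k $ t"] by (auto simp: \<Phi>_def A_def abs_le_iff)
    qed
  qed (auto simp: A_def)
  also have "\<dots> = (\<Prod>j\<in>UNIV. card (A j))" by (rule card_int_box)
  also have "\<dots> = (\<Prod>j\<in>insert i (insert t (UNIV - {i, t})). card (A j))" by (rule prod.cong) auto
  also have "\<dots> = card (A i) * (card (A t) * (\<Prod>j\<in>UNIV - {i, t}. card (A j)))"
    using ti by simp
  also have "(\<Prod>j\<in>UNIV - {i, t}. card (A j)) = (\<Prod>j\<in>UNIV - {i, t}. card {- \<lfloor>L\<rfloor>..\<lfloor>L\<rfloor>})"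
    by (rule prod.cong) (auto simp: A_def)
  also have "\<dots> = card {- \<lfloor>L\<rfloor>..\<lfloor>L\<rfloor>} ^ (CARD('n) - 2)"
    using ti by (simp add: card_Diff_subset numeral_2_eq_2)
  also have "card (A i) * (card (A t) * \<dots>) = nat (D + 1) * card {- \<lfloor>L\<rfloor>..\<lfloor>L\<rfloor>} ^ (CARD('n) - 2)"
    using ti by (simp add: A_def)
  finally have "real (card S) \<le> real (nat (D + 1)) * real (card {- \<lfloor>L\<rfloor>..\<lfloor>L\<rfloor>}) ^ (CARD('n) - 2)"
    by (metis of_nat_le_iff of_nat_power of_nat_mult)
  also have "\<dots> \<le> real (nat (D + 1)) * (2 * L + 1) ^ (CARD('n) - 2)"
    using card_symmetric_int_interval[OF L] by (intro mult_left_mono power_mono) auto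
  also have "real (nat (D + 1)) = of_int D + 1" using D by simp
  finally show ?thesis .
qed

text \<open>
  For \<open>m\<^sub>i \<noteq> 0\<close>, the vectors \<open>v\<^sub>t = m\<^sub>i e\<^sub>t - m\<^sub>t e\<^sub>i\<close> are orthogonal to \<open>m\<close>, and the projection
  \<open>w = k + m / 2\<close> of \<open>k\<close> to the hyperplane satisfies \<open>\<Sum>\<^sub>t w\<^sub>t (w \<bullet> v\<^sub>t) = m\<^sub>i |w|\<^sup>2\<close>, so \<open>k \<bullet> v\<^sub>t\<close> is of size
  \<open>|m\<^sub>i| R\<close> for some \<open>t\<close>. Along \<open>v\<^sub>t\<close> the shell is then crossed transversally: when all coordinates
  but the \<open>i\<close>-th and the \<open>t\<close>-th are fixed, \<open>k\<^sub>t\<close> takes boundedly many values.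
\<close>

lemma card_shell_slice_le_of_large_radius:
  fixes m :: "int ^ 'n::finite" and c R :: real
  assumes mi: "m $ i \<noteq> 0" and c: "c > 0" and R: "R > 0" "R \<ge> 4 * c" "norm (lattice_vec m) \<le> R"
  shows "real (card (shell_slice c R m)) \<le> 2 * CARD('n) * (2 * c * CARD('n) + 1) * (2 * (R + c) + 1) ^ (CARD('n) - 2)"
proof -
  define d where "d = real CARD('n)"
  have d: "d \<ge> 1" by (simp add: d_def Suc_le_eq)
  define q where "q t k = m $ i * k $ t - m $ t * k $ i" for t and k :: "int ^ 'n"
  \<comment> \<open>The sign \<open>s\<close> splits the points by the sign of \<open>q t k\<close>.
    For two points of the same class these values then add up instead of cancelling.\<close>
  define S where "S t s = {k \<in> shell_slice c R m. \<bar>real_of_int (m $ i)\<bar> * R \<le> 2 * d * (s * of_int (q t k))}" for t and s :: real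
  have slice: "lattice_vec k \<bullet> lattice_vec m = - (norm (lattice_vec m))\<^sup>2 / 2"
    "\<bar>(norm (lattice_vec k))\<^sup>2 - R\<^sup>2\<bar> \<le> c * R" if "k \<in> shell_slice c R m" for k
  proof -
    have "(norm (lattice_vec k + lattice_vec m))\<^sup>2 = (norm (lattice_vec k))\<^sup>2"
      using that by (simp add: shell_slice_def lattice_vec_add)
    then show "lattice_vec k \<bullet> lattice_vec m = - (norm (lattice_vec m))\<^sup>2 / 2"
      unfolding power2_norm_eq_inner by (simp add: inner_add_left inner_add_right inner_commute)
    show "\<bar>(norm (lattice_vec k))\<^sup>2 - R\<^sup>2\<bar> \<le> c * R" using that by (simp add: shell_slice_def shell_def)
  qed
  have cover: "shell_slice c R m \<subseteq> (\<Union>t\<in>UNIV. S t 1 \<union> S t (- 1))"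
  proof
    fix k assume k: "k \<in> shell_slice c R m"
    define w where "w = lattice_vec k + (1/2) *\<^sub>R lattice_vec m"
    have "w \<bullet> lattice_vec m = 0" unfolding w_def
      using slice(1)[OF k] by (simp add: inner_add_left power2_norm_eq_inner)
    then have "w \<bullet> lattice_vec k = w \<bullet> w" by (simp add: w_def inner_add_right)
    have ww: "w \<bullet> w = (norm (lattice_vec k))\<^sup>2 - (norm (lattice_vec m))\<^sup>2 / 4"
    proof -
      have "w \<bullet> lattice_vec k = lattice_vec k \<bullet> lattice_vec k + (lattice_vec k \<bullet> lattice_vec m) / 2"
        by (simp add: w_def inner_add_left inner_commute[of "lattice_vec m"])
      then show ?thesis
        using slice(1)[OF k] \<open>w \<bullet> lattice_vec k = w \<bullet> w\<close> by (simp add: power2_norm_eq_inner)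
    qed
    \<comment> \<open>Both size conditions on \<open>R\<close> enter here:
      \<open>R \<ge> 4 * c\<close> costs a quarter of \<open>R\<^sup>2\<close> in the norm of
      \<open>k\<close>, and \<open>|m| \<le> R\<close> costs another quarter in passing to
      \<open>w\<close>. Half of \<open>R\<^sup>2\<close> remains.\<close>
    have "(norm (lattice_vec m))\<^sup>2 \<le> R\<^sup>2" using R by (intro power_mono) auto
    moreover have "c * R \<le> (R / 4) * R" using R by (intro mult_right_mono) auto
    ultimately have ww2: "w \<bullet> w \<ge> R\<^sup>2 / 2" using ww slice(2)[OF k] by (simp add: abs_le_iff power2_eq_square)
    have sumq: "(\<Sum>t\<in>UNIV. w $ t * of_int (q t k)) = of_int (m $ i) * (w \<bullet> w)"
    proof -
      have "(\<Sum>t\<in>UNIV. w $ t * of_int (q t k)) = of_int (m $ i) * (w \<bullet> lattice_vec k) - of_int (k $ i) * (w \<bullet> lattice_vec m)"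
        by (simp add: q_def inner_vec_def sum_distrib_left sum_subtractf algebra_simps)
      then show ?thesis using \<open>w \<bullet> lattice_vec m = 0\<close> \<open>w \<bullet> lattice_vec k = w \<bullet> w\<close> by simp
    qed
    \<comment> \<open>If every \<open>q t k\<close> were smaller, \<open>sumq\<close> would give
      \<open>norm w \<le> R / 2\<close>, against
      \<open>w \<bullet> w \<ge> R\<^sup>2 / 2\<close>.\<close>
    have "\<exists>t. \<bar>real_of_int (m $ i)\<bar> * R \<le> 2 * d * \<bar>real_of_int (q t k)\<bar>"
    proof (rule ccontr)
      assume "\<not> ?thesis"
      then have lt: "\<bar>real_of_int (q t k)\<bar> \<le> \<bar>real_of_int (m $ i)\<bar> * R / (2 * d)" for t
        using d by (auto simp: not_le field_simps less_imp_le)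
      have "\<bar>real_of_int (m $ i)\<bar> * (w \<bullet> w) = \<bar>\<Sum>t\<in>UNIV. w $ t * of_int (q t k)\<bar>"
        by (simp add: sumq abs_mult)
      also have "\<dots> \<le> (\<Sum>t\<in>UNIV. \<bar>w $ t * of_int (q t k)\<bar>)" by (rule sum_abs)
      also have "\<dots> \<le> (\<Sum>t\<in>(UNIV::'n set). norm w * (\<bar>real_of_int (m $ i)\<bar> * R / (2 * d)))"
        using lt component_le_norm_cart[of w] unfolding abs_mult
        by (intro sum_mono mult_mono) auto
      also have "\<dots> = norm w * \<bar>real_of_int (m $ i)\<bar> * R / 2" using d by (simp add: d_def)
      finally have "\<bar>real_of_int (m $ i)\<bar> * (norm w * norm w) \<le> \<bar>real_of_int (m $ i)\<bar> * (norm w * R / 2)"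
        by (simp add: dot_square_norm power2_eq_square mult_ac)
      then have "norm w * norm w \<le> norm w * R / 2" using mi by simp
      moreover have "norm w * norm w \<ge> R * R / 2" using ww2 by (simp add: dot_square_norm power2_eq_square)
      moreover have "norm w > 0" using ww2 R(1) by (metis inner_gt_zero_iff zero_less_norm_iff half_gt_zero less_le_trans zero_less_power)
      ultimately have "norm w \<le> R / 2" "R * R / 2 \<le> norm w * norm w" by auto
      moreover have "norm w * norm w \<le> (R / 2) * (R / 2)" using \<open>norm w \<le> R / 2\<close> R(1) by (intro mult_mono) auto
      ultimately show False using R(1) mult_pos_pos[OF R(1) R(1)] by simp
    qed
    then obtain t where "\<bar>real_of_int (m $ i)\<bar> * R \<le> 2 * d * \<bar>real_of_int (q t k)\<bar>" by blast
    then have "k \<in> S t 1 \<union> S t (- 1)" using k by (cases "q t k \<ge> 0") (auto simp: S_def)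
    then show "k \<in> (\<Union>t\<in>UNIV. S t 1 \<union> S t (- 1))" by blast
  qed
  have fin: "finite (shell_slice c R m)" by (rule finite_subset[OF _ finite_shell[OF c R(1)]]) (auto simp: shell_slice_def)
  have each: "real (card (S t s)) \<le> (2 * c * d + 1) * (2 * (R + c) + 1) ^ (CARD('n) - 2)" if s: "\<bar>s\<bar> = 1" for t s
  proof (cases "t = i")
    case True
    have "S t s = {}" using mi R(1) True by (auto simp: S_def q_def mult_le_0_iff)
    then show ?thesis using c R d by simp
  next
    case False
    \<comment> \<open>Squared norms in the shell differ by at most \<open>2 * c * R\<close>.
      Multiplied by \<open>m $ i\<close>, such a difference equals
      \<open>(k $ t - l $ t) * (q t k + q t l)\<close>, whose second factor is at least
      \<open>|m $ i| * R / d\<close> in absolute value.\<close>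
    define D where "D = \<lfloor>2 * c * d\<rfloor>"
    have D: "D \<ge> 0" "of_int D \<le> 2 * c * d" using c d by (auto simp: D_def)
    have "real (card (S t s)) \<le> (of_int D + 1) * (2 * (R + c) + 1) ^ (CARD('n) - 2)"
    proof (rule card_slice_fibre_le[OF mi False D(1)])
      show "0 \<le> R + c" using c R by simp
      show "norm (lattice_vec k) \<le> R + c" if "k \<in> S t s" for k
        using that shell_subset_ball[OF c R(1)] by (auto simp: S_def shell_slice_def)
      have hyp: "(\<Sum>j\<in>UNIV. m $ j * (k $ j - l $ j)) = 0" if "k \<in> S t s" "l \<in> S t s" for k l
      proof -
        have "real_of_int (\<Sum>j\<in>UNIV. m $ j * (k $ j - l $ j)) = lattice_vec k \<bullet> lattice_vec m - lattice_vec l \<bullet> lattice_vec m"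
          by (simp add: inner_vec_def sum_subtractf algebra_simps)
        also have "\<dots> = 0" using slice(1) that by (simp add: S_def)
        finally show ?thesis by (simp only: of_int_eq_0_iff)
      qed
      then show "(\<Sum>j\<in>UNIV. m $ j * (k $ j - l $ j)) = 0" if "k \<in> S t s" "l \<in> S t s" for k l
        using that by blast
      show "\<bar>k $ t - l $ t\<bar> \<le> D" if kl: "k \<in> S t s" "l \<in> S t s" and off: "\<And>j. j \<noteq> i \<Longrightarrow> j \<noteq> t \<Longrightarrow> k $ j = l $ j" for k l
      proof -
        have "0 = (\<Sum>j\<in>UNIV. m $ j * (k $ j - l $ j))" using hyp[OF kl] by simp
        also have "\<dots> = (\<Sum>j\<in>{i,t}. m $ j * (k $ j - l $ j))"
          by (rule sum.mono_neutral_right) (use off in auto)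
        finally have h: "m $ i * (k $ i - l $ i) = - (m $ t * (k $ t - l $ t))" using False by simp
        define e where "e = (\<Sum>j\<in>UNIV. (k $ j)\<^sup>2 - (l $ j)\<^sup>2)"
        have "e = (\<Sum>j\<in>{i,t}. (k $ j)\<^sup>2 - (l $ j)\<^sup>2)"
          unfolding e_def by (rule sum.mono_neutral_right) (use off in auto)
        then have e2: "e = (k $ i)\<^sup>2 - (l $ i)\<^sup>2 + ((k $ t)\<^sup>2 - (l $ t)\<^sup>2)" using False by simp
        \<comment> \<open>The factor \<open>m $ i\<close> makes room for the hyperplane relation
          \<open>h\<close>, which removes the difference of the \<open>i\<close>-th coordinates and
          leaves a product with \<open>k $ t - l $ t\<close>.\<close>
        have "m $ i * e = (m $ i * (k $ i - l $ i)) * (k $ i + l $ i) + m $ i * (k $ t - l $ t) * (k $ t + l $ t)"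
          unfolding e2 by (simp add: power2_eq_square algebra_simps)
        then have me: "m $ i * e = (k $ t - l $ t) * (q t k + q t l)"
          unfolding h q_def by (simp add: algebra_simps)
        have "real_of_int e = (norm (lattice_vec k))\<^sup>2 - (norm (lattice_vec l))\<^sup>2"
          by (simp add: e_def norm_lattice_vec sum_subtractf)
        then have e: "\<bar>real_of_int e\<bar> \<le> 2 * c * R"
          using slice(2)[of k] slice(2)[of l] kl by (simp add: S_def abs_le_iff)
        have "\<bar>real_of_int (m $ i)\<bar> * R \<le> d * (s * (of_int (q t k) + of_int (q t l)))"
          using kl by (simp add: S_def algebra_simps)
        also have "s * (of_int (q t k) + of_int (q t l)) \<le> \<bar>s * (of_int (q t k) + of_int (q t l))\<bar>" by simp
        also have "\<dots> = \<bar>of_int (q t k) + of_int (q t l)\<bar>" using s by (simp add: abs_mult)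
        finally have qq: "\<bar>real_of_int (m $ i)\<bar> * R \<le> d * \<bar>of_int (q t k) + of_int (q t l)\<bar>" using d by simp
        have "\<bar>real_of_int (k $ t - l $ t)\<bar> * (\<bar>real_of_int (m $ i)\<bar> * R) \<le> \<bar>real_of_int (k $ t - l $ t)\<bar> * (d * \<bar>of_int (q t k) + of_int (q t l)\<bar>)"
          by (intro mult_left_mono qq) simp
        also have "\<dots> = d * \<bar>real_of_int ((k $ t - l $ t) * (q t k + q t l))\<bar>" by (simp add: abs_mult)
        also have "\<dots> = d * (\<bar>real_of_int (m $ i)\<bar> * \<bar>real_of_int e\<bar>)" unfolding me[symmetric] by (simp add: abs_mult)
        also have "\<dots> \<le> d * (\<bar>real_of_int (m $ i)\<bar> * (2 * c * R))" using d by (intro mult_left_mono e) auto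
        finally have "\<bar>real_of_int (k $ t - l $ t)\<bar> * (\<bar>real_of_int (m $ i)\<bar> * R) \<le> (2 * c * d) * (\<bar>real_of_int (m $ i)\<bar> * R)"
          by (simp add: mult_ac)
        then have "\<bar>real_of_int (k $ t - l $ t)\<bar> \<le> 2 * c * d" 
          by (rule mult_right_le_imp_le) (use mi R(1) in simp)
        then show ?thesis unfolding D_def by (simp add: le_floor_iff)
      qed
    qed
    also have "\<dots> \<le> (2 * c * d + 1) * (2 * (R + c) + 1) ^ (CARD('n) - 2)"
      using D(2) c R by (intro mult_right_mono) auto
    finally show ?thesis .
  qed
  have "card (shell_slice c R m) \<le> card (\<Union>t\<in>UNIV. S t 1 \<union> S t (- 1))"
    using fin by (intro card_mono[OF _ cover]) (auto simp: S_def)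
  also have "\<dots> \<le> (\<Sum>t\<in>UNIV. card (S t 1 \<union> S t (- 1)))" by (rule card_UN_le) simp
  also have "\<dots> \<le> (\<Sum>t\<in>UNIV. card (S t 1) + card (S t (- 1)))" by (intro sum_mono card_Un_le)
  finally have "real (card (shell_slice c R m)) \<le> (\<Sum>t\<in>UNIV. real (card (S t 1)) + real (card (S t (- 1))))"
    by (metis (mono_tags, lifting) of_nat_add of_nat_le_iff of_nat_sum sum.cong)
  also have "\<dots> \<le> (\<Sum>t\<in>(UNIV :: 'n set). 2 * ((2 * c * d + 1) * (2 * (R + c) + 1) ^ (CARD('n) - 2)))"
  proof (rule sum_mono)
    fix t
    show "real (card (S t 1)) + real (card (S t (- 1))) \<le> 2 * ((2 * c * d + 1) * (2 * (R + c) + 1) ^ (CARD('n) - 2))"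
      using each[of 1 t] each[of "- 1" t] by simp
  qed
  also have "\<dots> = 2 * d * (2 * c * d + 1) * (2 * (R + c) + 1) ^ (CARD('n) - 2)" by (simp add: d_def)
  finally show ?thesis by (simp add: d_def)
qed

lemma one_le_norm_lattice_vec:
  assumes "m \<noteq> 0" shows "1 \<le> norm (lattice_vec m)"
proof -
  obtain i where "m $ i \<noteq> 0" using assms by (auto simp: vec_eq_iff)
  then have "1 \<le> \<bar>lattice_vec m $ i\<bar>" by simp
  then show ?thesis using component_le_norm_cart[of "lattice_vec m" i] by linarith
qed

text \<open>The factor \<open>|m|\<^sup>2\<close> comes from the regime outside the transversality
  argument: if \<open>R < 4 * c\<close> or \<open>|m| > R\<close>, then \<open>R\<^sup>2\<close> is
  at most \<open>1 + 16 * c\<^sup>2\<close> times \<open>|m|\<^sup>2\<close>, so even the trivial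
  count of a whole ball suffices. The bound \<open>R \<ge> R0\<close> lets \<open>B\<close> turn
  \<open>2 * (R + c) + 1\<close> into a multiple of \<open>R\<close>; \<open>C\<close> adds the
  constants of the two regimes.\<close>

lemma card_shell_slice_le:
  assumes c: "c > 0" and R0: "R0 > 0" and d: "CARD('n::finite) \<ge> 2"
  shows "\<exists>C>0. \<forall>R\<ge>R0. \<forall>m :: int ^ 'n. m \<noteq> 0 \<longrightarrow>
    real (card (shell_slice c R m)) \<le> C * (norm (lattice_vec m))\<^sup>2 * R ^ (CARD('n) - 2)"
proof -
  define n where "n = CARD('n)"
  define B where "B = 2 + (2 * c + 1) / R0"
  define C where "C = 2 * n * (2 * c * n + 1) * B ^ (n - 2) + B ^ n * (1 + 16 * c\<^sup>2)"
  have B: "B > 0" using c R0 by (simp add: B_def add_pos_nonneg)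
  have C: "C > 0" unfolding C_def using B c by (intro add_nonneg_pos mult_pos_pos add_pos_nonneg) auto
  have "real (card (shell_slice c R m)) \<le> C * (norm (lattice_vec m))\<^sup>2 * R ^ (n - 2)"
    if R: "R \<ge> R0" and m: "m \<noteq> 0" for R and m :: "int ^ 'n"
  proof -
    have R1: "R > 0" using R R0 by simp
    have BR: "2 * (R + c) + 1 \<le> B * R"
    proof -
      have "(2 * c + 1) / R0 * R0 \<le> (2 * c + 1) / R0 * R" using R R0 c by (intro mult_left_mono) auto
      moreover have "(2 * c + 1) / R0 * R0 = 2 * c + 1" using R0 by simp
      moreover have "B * R = 2 * R + (2 * c + 1) / R0 * R" by (simp add: B_def distrib_right)
      ultimately show ?thesis by simp
    qed
    note m1 = one_le_norm_lattice_vec[OF m]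
    then have m2: "1 \<le> (norm (lattice_vec m))\<^sup>2" by simp
    show ?thesis
    proof (cases "R \<ge> 4 * c \<and> norm (lattice_vec m) \<le> R")
      case True
      obtain i where "m $ i \<noteq> 0" using m by (auto simp: vec_eq_iff)
      then have "real (card (shell_slice c R m)) \<le> 2 * n * (2 * c * n + 1) * (2 * (R + c) + 1) ^ (n - 2)"
        unfolding n_def using True by (intro card_shell_slice_le_of_large_radius c R1) auto
      also have "\<dots> \<le> 2 * n * (2 * c * n + 1) * (B * R) ^ (n - 2)"
        using c R1 BR by (intro mult_left_mono power_mono) auto
      also have "\<dots> = (2 * n * (2 * c * n + 1) * B ^ (n - 2)) * (1 * R ^ (n - 2))"
        by (simp add: power_mult_distrib)
      also have "\<dots> \<le> C * ((norm (lattice_vec m))\<^sup>2 * R ^ (n - 2))"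
        using m2 B R1 c unfolding C_def
        by (intro mult_mono) (auto intro!: mult_right_mono mult_nonneg_nonneg add_nonneg_nonneg)
      finally show ?thesis by (simp add: mult.assoc)
    next
      case False
      have R2: "R\<^sup>2 \<le> (1 + 16 * c\<^sup>2) * (norm (lattice_vec m))\<^sup>2"
      proof (cases "R < 4 * c")
        case True
        then have "R\<^sup>2 \<le> (4 * c)\<^sup>2" using R1 by (intro power_mono) auto
        also have "\<dots> \<le> (1 + 16 * c\<^sup>2) * 1" by (simp add: power_mult_distrib)
        also have "\<dots> \<le> (1 + 16 * c\<^sup>2) * (norm (lattice_vec m))\<^sup>2" using m2 by (intro mult_left_mono) auto
        finally show ?thesis .
      next
        case nc: False
        then have "R\<^sup>2 \<le> 1 * (norm (lattice_vec m))\<^sup>2" using False R1 by (auto intro!: power_mono)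
        also have "\<dots> \<le> (1 + 16 * c\<^sup>2) * (norm (lattice_vec m))\<^sup>2" by (intro mult_right_mono) auto
        finally show ?thesis .
      qed
      have "card (shell_slice c R m) \<le> card {k :: int ^ 'n. norm (lattice_vec k) \<le> R + c}"
        using shell_subset_ball[OF c R1] by (intro card_mono finite_lattice_ball) (auto simp: shell_slice_def)
      then have "real (card (shell_slice c R m)) \<le> real (card {k :: int ^ 'n. norm (lattice_vec k) \<le> R + c})" by simp
      also have "\<dots> \<le> (2 * (R + c) + 1) ^ n" unfolding n_def using c R1 by (intro card_lattice_ball_le) simp
      also have "\<dots> \<le> (B * R) ^ n" using c R1 BR by (intro power_mono) auto
      also have "\<dots> = B ^ n * R ^ (n - 2) * R\<^sup>2"
      proof -
        have "R ^ n = R ^ (n - 2) * R\<^sup>2" using d by (metis le_add_diff_inverse2 n_def power_add)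
        then show ?thesis by (simp add: power_mult_distrib)
      qed
      also have "\<dots> \<le> B ^ n * R ^ (n - 2) * ((1 + 16 * c\<^sup>2) * (norm (lattice_vec m))\<^sup>2)"
        using B R1 by (intro mult_left_mono R2) auto
      also have "\<dots> = (B ^ n * (1 + 16 * c\<^sup>2)) * ((norm (lattice_vec m))\<^sup>2 * R ^ (n - 2))" by (simp add: mult_ac)
      also have "\<dots> \<le> C * ((norm (lattice_vec m))\<^sup>2 * R ^ (n - 2))"
        unfolding C_def using B c R1 by (intro mult_right_mono) auto
      finally show ?thesis by (simp add: mult.assoc)
    qed
  qed
  then show ?thesis using C unfolding n_def by blast
qed

section \<open>Lower bound for the number of lattice points in a shell\<close>

lemma card_int_interval_ge: "b - a - 1 \<le> real (card {\<lceil>a\<rceil>..\<lfloor>b\<rfloor>})"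
  by simp linarith

text \<open>
  Where the sphere is almost parallel to \<open>e\<^sub>i\<close>, that is for \<open>|y|\<close> slightly below \<open>R\<close> with \<open>y\<^sub>i = 0\<close>,
  the point of the sphere above \<open>y\<close> has an \<open>i\<close>-th coordinate that is a small multiple of \<open>R\<close>, and
  rounding it down to \<open>x\<close> changes the squared norm by at most \<open>2 x + 1\<close>, hence by less than \<open>c R\<close>.
\<close>

lemma card_shell_ge:
  assumes c: "c > 0" and d: "CARD('n::finite) \<ge> 2"
  shows "\<exists>\<eta>>0. \<exists>R0>0. \<forall>R\<ge>R0. \<eta> * R ^ (CARD('n) - 1) \<le> real (card (shell c R :: (int ^ 'n) set))"
proof -
  obtain i l :: 'n where il: "l \<noteq> i"
  proof -
    have "\<not> is_singleton (UNIV :: 'n set)" using d by (simp add: is_singleton_altdef)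
    then show ?thesis using that by (metis UNIV_I is_singletonI' UNIV_not_empty)
  qed
  define n where "n = CARD('n)"
  have n: "n \<ge> 2" using d by (simp add: n_def)
  \<comment> \<open>The first bound keeps \<open>|y| \<le> R\<close>, so that the sphere has a point
    above \<open>y\<close>. The second makes its height at most
    \<open>2 * sqrt e * R \<le> c * R / 4\<close>.\<close>
  define e where "e = min (1 / (4 * real n)) (c\<^sup>2 / 64)"
  have e: "e > 0" "e \<le> 1 / (4 * real n)" "e \<le> c\<^sup>2 / 64" using c n by (auto simp: e_def)
  have e1: "real n * e \<le> 1 / 4" using e(2) n by (simp add: field_simps)
  have "1 * e \<le> real n * e" using n e(1) by (intro mult_right_mono) auto
  then have e4: "e \<le> 1 / 4" using e1 by simp
  have se: "sqrt e \<le> c / 8"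
    using e(3) c by (intro real_le_lsqrt) (auto simp: power_divide)
  define \<eta> where "\<eta> = (e / 2) ^ (n - 1)"
  \<comment> \<open>\<open>c * R \<ge> 2\<close> absorbs the rounding error, as
    \<open>2 * x + 1 \<le> c * R / 2 + 1 \<le> c * R\<close>. \<open>e * R \<ge> 2\<close> ensures
    that an interval of length \<open>e * R\<close> contains at least \<open>e * R / 2\<close>
    integers.\<close>
  define R0 where "R0 = max (2 / c) (2 / e)"
  have "\<eta> * R ^ (n - 1) \<le> real (card (shell c R :: (int ^ 'n) set))" if R: "R \<ge> R0" for R
  proof -
    have R1: "R > 0" using R c unfolding R0_def by (metis divide_pos_pos less_le_trans max.bounded_iff zero_less_numeral)
    have Rc: "c * R \<ge> 2" "e * R \<ge> 2" using R c e(1) by (auto simp: R0_def field_simps)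
    \<comment> \<open>The \<open>l\<close>-th coordinate carries almost the whole norm and the
      others are small. The value 0 at \<open>i\<close> is a placeholder that \<open>\<Psi>\<close>
      replaces by the rounded height; the other \<open>n - 1\<close> coordinates are free.\<close>
    define A where "A j = (if j = i then {0} else if j = l then {\<lceil>(1 - 2 * e) * R\<rceil>..\<lfloor>(1 - e) * R\<rfloor>} else {0..\<lfloor>e * R\<rfloor>})" for j
    define Y where "Y = {y :: int ^ 'n. \<forall>j. y $ j \<in> A j}"
    define s where "s y = sqrt (R\<^sup>2 - (norm (lattice_vec y))\<^sup>2)" for y :: "int ^ 'n"
    define \<Psi> where "\<Psi> y = (\<chi> j. if j = i then \<lfloor>s y\<rfloor> else y $ j)" for y
    have inj: "inj_on \<Psi> Y"
    proof (rule inj_onI)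
      fix y z assume yz: "y \<in> Y" "z \<in> Y" "\<Psi> y = \<Psi> z"
      have "y $ j = z $ j" for j
      proof (cases "j = i")
        case True
        have "y $ i \<in> A i" "z $ i \<in> A i" using yz by (auto simp: Y_def)
        then show ?thesis using True by (simp add: A_def)
      next
        case False
        have "\<Psi> y $ j = \<Psi> z $ j" using yz by simp
        then show ?thesis using False by (simp add: \<Psi>_def)
      qed
      then show "y = z" by (simp add: vec_eq_iff)
    qed
    have into: "\<Psi> ` Y \<subseteq> shell c R"
    proof
      fix k assume "k \<in> \<Psi> ` Y"
      then obtain y where y: "y \<in> Y" and k: "k = \<Psi> y" by blast
      have yA: "y $ j \<in> A j" for j using y by (simp add: Y_def)
      have yi: "y $ i = 0" using yA[of i] by (simp add: A_def)
      have yl: "(1 - 2 * e) * R \<le> y $ l" "y $ l \<le> (1 - e) * R"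
        using yA[of l] il by (auto simp: A_def ceiling_le_iff le_floor_iff)
      have yj: "(real_of_int (y $ j))\<^sup>2 \<le> (e * R)\<^sup>2" if "j \<noteq> l" for j
      proof (cases "j = i")
        case False
        then show ?thesis using yA[of j] that by (intro power_mono) (auto simp: A_def le_floor_iff)
      qed (simp add: yi)
      have ny: "(norm (lattice_vec y))\<^sup>2 = (real_of_int (y $ l))\<^sup>2 + (\<Sum>j\<in>UNIV - {l}. (real_of_int (y $ j))\<^sup>2)"
        unfolding norm_lattice_vec by (rule sum.remove) auto
      have lo: "(1 - 4 * e) * R\<^sup>2 \<le> (norm (lattice_vec y))\<^sup>2"
      proof -
        have "(1 - 4 * e) * R\<^sup>2 \<le> (1 - 2 * e)\<^sup>2 * R\<^sup>2"
          by (intro mult_right_mono) (auto simp: power2_eq_square algebra_simps)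
        also have "\<dots> = ((1 - 2 * e) * R)\<^sup>2" by (simp add: power_mult_distrib)
        also have "\<dots> \<le> (real_of_int (y $ l))\<^sup>2" using yl e4 R1 by (intro power_mono) auto
        also have "\<dots> \<le> (norm (lattice_vec y))\<^sup>2" unfolding ny by (simp add: sum_nonneg)
        finally show ?thesis .
      qed
      have hi: "(norm (lattice_vec y))\<^sup>2 \<le> R\<^sup>2"
      proof -
        have "0 \<le> (1 - 2 * e) * R" using e4 R1 by simp
        then have "(real_of_int (y $ l))\<^sup>2 \<le> ((1 - e) * R)\<^sup>2" using yl by (intro power_mono) auto
        moreover have "(\<Sum>j\<in>UNIV - {l}. (real_of_int (y $ j))\<^sup>2) \<le> (\<Sum>j\<in>UNIV - {l}. (e * R)\<^sup>2)"
          by (intro sum_mono yj) auto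
        moreover have "(\<Sum>j\<in>UNIV - {l}. (e * R)\<^sup>2) \<le> real n * (e * R)\<^sup>2"
          by (simp add: n_def mult_right_mono)
        moreover have "real n * (e * R)\<^sup>2 = (real n * e) * (e * R\<^sup>2)" by (simp add: power2_eq_square)
        moreover have "(real n * e) * (e * R\<^sup>2) \<le> 1 / 4 * (e * R\<^sup>2)" using e1 e(1) by (intro mult_right_mono) auto
        moreover have "((1 - e) * R)\<^sup>2 = R\<^sup>2 - 2 * (e * R\<^sup>2) + e * (e * R\<^sup>2)" by (simp add: power2_eq_square algebra_simps)
        moreover have "e * (e * R\<^sup>2) \<le> 1 / 4 * (e * R\<^sup>2)" using e4 e(1) by (intro mult_right_mono) auto
        moreover have "e * R\<^sup>2 \<ge> 0" using e(1) by simp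
        ultimately show ?thesis unfolding ny by linarith
      qed
      have s2: "(s y)\<^sup>2 = R\<^sup>2 - (norm (lattice_vec y))\<^sup>2" using hi by (simp add: s_def)
      have s0: "s y \<ge> 0" using hi by (simp add: s_def)
      have "s y \<le> sqrt (4 * e * R\<^sup>2)" unfolding s_def using lo by (intro real_sqrt_le_mono) (simp add: algebra_simps)
      also have "\<dots> = 2 * sqrt e * R" using R1 by (simp add: real_sqrt_mult)
      also have "\<dots> \<le> 2 * (c / 8) * R" using se R1 by (intro mult_right_mono mult_left_mono) auto
      finally have sc: "s y \<le> c * R / 4" by simp
      define x where "x = real_of_int \<lfloor>s y\<rfloor>"
      have x: "0 \<le> x" "x \<le> s y" "s y \<le> x + 1" using s0 by (auto simp: x_def)
      have "(norm (lattice_vec k))\<^sup>2 = x\<^sup>2 + (\<Sum>j\<in>UNIV - {i}. (real_of_int (y $ j))\<^sup>2)"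
        unfolding norm_lattice_vec by (subst sum.remove[of _ i]) (auto simp: k \<Psi>_def x_def)
      also have "(\<Sum>j\<in>UNIV - {i}. (real_of_int (y $ j))\<^sup>2) = (norm (lattice_vec y))\<^sup>2"
        unfolding norm_lattice_vec by (subst (2) sum.remove[of _ i]) (auto simp: yi)
      finally have nk: "R\<^sup>2 - (norm (lattice_vec k))\<^sup>2 = (s y)\<^sup>2 - x\<^sup>2" using s2 by simp
      have "x\<^sup>2 \<le> (s y)\<^sup>2" using x by (intro power_mono) auto
      moreover have "(s y)\<^sup>2 \<le> (x + 1)\<^sup>2" using x s0 by (intro power_mono) auto
      moreover have "(x + 1)\<^sup>2 = x\<^sup>2 + 2 * x + 1" by (simp add: power2_eq_square algebra_simps)
      ultimately have "\<bar>(norm (lattice_vec k))\<^sup>2 - R\<^sup>2\<bar> \<le> c * R" unfolding abs_le_iff using nk x sc Rc(1) by (intro conjI) linarith+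
      then show "k \<in> shell c R" by (simp add: shell_def)
    qed
    have Aj: "e / 2 * R \<le> real (card (A j))" if "j \<noteq> i" for j
    proof (cases "j = l")
      case True
      have "(1 - e) * R - (1 - 2 * e) * R - 1 \<le> real (card {\<lceil>(1 - 2 * e) * R\<rceil>..\<lfloor>(1 - e) * R\<rfloor>})"
        by (rule card_int_interval_ge)
      then show ?thesis using True il Rc(2) by (simp add: A_def algebra_simps)
    next
      case False
      have "e * R / 2 \<le> real_of_int \<lfloor>e * R\<rfloor> + 1" using Rc(2) by linarith
      then show ?thesis using False that Rc(2) by (simp add: A_def)
    qed
    have "\<eta> * R ^ (n - 1) = (\<Prod>j\<in>UNIV - {i}. e / 2 * R)"
      by (simp add: \<eta>_def n_def flip: power_mult_distrib)
    also have "\<dots> \<le> (\<Prod>j\<in>UNIV - {i}. real (card (A j)))"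
      using Aj e(1) R1 by (intro prod_mono) auto
    also have "\<dots> = (\<Prod>j\<in>UNIV. real (card (A j)))"
      by (subst (2) prod.remove[of _ i]) (auto simp: A_def)
    also have "\<dots> = real (card Y)" unfolding Y_def card_int_box by simp
    also have "card Y = card (\<Psi> ` Y)" using inj by (simp add: card_image)
    also have "real \<dots> \<le> real (card (shell c R :: (int ^ 'n) set))"
      using card_mono[OF finite_shell[OF c R1] into] by simp
    finally show ?thesis .
  qed
  moreover have "\<eta> > 0" "R0 > 0" using e(1) c by (auto simp: \<eta>_def R0_def less_max_iff_disj)
  ultimately show ?thesis unfolding n_def by blast
qed

text \<open>The power in the slice bound is \<open>R ^ (CARD('n) - 1)\<close> divided by
  \<open>R\<close>, and the numerator is at most a multiple of \<open>N\<close>: by the shell count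
  for large \<open>R\<close>, and by \<open>N \<ge> 1\<close> below its threshold \<open>R1\<close>.
  Taking any \<open>N\<close> above the shell count allows the dimension to be inserted
  later.\<close>

lemma card_shell_slice_le_card_shell:
  assumes c: "c > 0" and R0: "R0 > 0" and d: "CARD('n::finite) \<ge> 2"
  shows "\<exists>C>0. \<forall>R\<ge>R0. \<forall>N\<ge>1. real (card (shell c R :: (int ^ 'n) set)) \<le> N \<longrightarrow>
    (\<forall>m :: int ^ 'n. m \<noteq> 0 \<longrightarrow>
      real (card (shell_slice c R m)) \<le> C * (norm (lattice_vec m))\<^sup>2 * (N / R))"
proof -
  obtain C1 where C1: "C1 > 0" "\<And>R (m :: int ^ 'n). R \<ge> R0 \<Longrightarrow> m \<noteq> 0 \<Longrightarrow>
      real (card (shell_slice c R m)) \<le> C1 * (norm (lattice_vec m))\<^sup>2 * R ^ (CARD('n) - 2)"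
    using card_shell_slice_le[OF c R0 d] by blast
  obtain \<eta> R1 where \<eta>: "\<eta> > 0" "R1 > 0"
      "\<And>R. R \<ge> R1 \<Longrightarrow> \<eta> * R ^ (CARD('n) - 1) \<le> real (card (shell c R :: (int ^ 'n) set))"
    using card_shell_ge[OF c d] by blast
  define A where "A = 1 / \<eta> + R1 ^ (CARD('n) - 1)"
  have A: "A > 0" using \<eta> by (simp add: A_def add_pos_pos)
  have "real (card (shell_slice c R m)) \<le> (C1 * A) * (norm (lattice_vec m))\<^sup>2 * (N / R)"
    if R: "R \<ge> R0" and N: "N \<ge> 1" "real (card (shell c R :: (int ^ 'n) set)) \<le> N" and m: "m \<noteq> 0"
    for R N and m :: "int ^ 'n"
  proof -
    have R': "R > 0" using R R0 by simp
    have "CARD('n) - 1 = Suc (CARD('n) - 2)" using d by simp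
    then have pw: "x ^ (CARD('n) - 1) = x * x ^ (CARD('n) - 2)" for x :: real by simp
    have "R ^ (CARD('n) - 1) \<le> A * N"
    proof (cases "R \<ge> R1")
      case True
      then have "\<eta> * R ^ (CARD('n) - 1) \<le> N" using \<eta>(3) N(2) by fastforce
      then have "R ^ (CARD('n) - 1) \<le> (1 / \<eta>) * N" using \<eta>(1) by (simp add: field_simps)
      also have "\<dots> \<le> A * N" using \<eta> N(1) by (intro mult_right_mono) (auto simp: A_def)
      finally show ?thesis .
    next
      case False
      then have "R ^ (CARD('n) - 1) \<le> R1 ^ (CARD('n) - 1) * 1" using R' by (simp add: power_mono)
      also have "\<dots> \<le> A * N" using \<eta> N(1) by (intro mult_mono) (auto simp: A_def add_nonneg_nonneg)
      finally show ?thesis .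
    qed
    then have "R ^ (CARD('n) - 2) \<le> A * (N / R)" using R' unfolding pw by (simp add: field_simps)
    then have "C1 * (norm (lattice_vec m))\<^sup>2 * R ^ (CARD('n) - 2) \<le> C1 * (norm (lattice_vec m))\<^sup>2 * (A * (N / R))"
      using C1(1) by (intro mult_left_mono) auto
    then show ?thesis using C1(2)[OF R m] by (simp add: mult_ac)
  qed
  then show ?thesis using mult_pos_pos[OF C1(1) A] by blast
qed

section \<open>Fourier coefficients of eigenfunctions\<close>

lemma ae_equal_rep: "ae_equal (l2_rep u) (l2_rep u)"
  by (rule Quotient3_rep_reflp[OF Quotient3_l2])

lemma square_integrable_rep: "square_integrable (l2_rep u)"
  using ae_equal_rep[of u] by (simp add: ae_equal_def)

lemma integrable_rep: "integrable torus (l2_rep u)"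
  by (rule square_integrable_imp_integrable[OF square_integrable_rep])

lemma l2_class_rep: "l2_class (l2_rep u) = u"
  by (rule Quotient3_abs_rep[OF Quotient3_l2])

lemma l2_rep_class:
  assumes "square_integrable f" shows "AE x in torus. l2_rep (l2_class f) x = f x"
proof -
  have "ae_equal f f" using assms by (simp add: ae_equal_def)
  then have "ae_equal (l2_rep (l2_class f)) f" by (rule Quotient3_rep_abs[OF Quotient3_l2])
  then show ?thesis by (simp add: ae_equal_def)
qed

lemma l2_rep_add: "AE x in torus. l2_rep (u + v) x = l2_rep u x + l2_rep v x"
proof -
  have "u + v = l2_class (\<lambda>x. l2_rep u x + l2_rep v x)"
    using plus_l2.abs_eq[OF ae_equal_rep ae_equal_rep, of u v] by (simp add: l2_class_rep)
  then show ?thesis using l2_rep_class[OF square_integrable_add[OF square_integrable_rep square_integrable_rep], of u v] by simp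
qed

lemma l2_rep_scale: "AE x in torus. l2_rep (l2_scale c u) x = c * l2_rep u x"
proof -
  have "l2_scale c u = l2_class (\<lambda>x. c * l2_rep u x)"
    using l2_scale.abs_eq[OF ae_equal_rep, of c u] by (simp add: l2_class_rep)
  then show ?thesis using l2_rep_class[OF square_integrable_scale[OF square_integrable_rep], of c u] by simp
qed

definition l2_fourier :: "'n::finite l2 \<Rightarrow> int ^ 'n \<Rightarrow> complex" where
  "l2_fourier u = fourier_coeff (l2_rep u)"

text \<open>\<open>l2_rep\<close> returns an unspecified representative, so an explicit function can
  replace it only almost everywhere and under an integral.\<close>

lemma integral_rep_continuous_cong:
  assumes "AE x in torus. l2_rep u x = g x" "g \<in> borel_measurable torus" "continuous_on UNIV \<phi>"
  shows "(LINT x|torus. l2_rep u x * \<phi> x) = (LINT x|torus. g x * \<phi> x)"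
proof (rule integral_cong_AE)
  have "\<phi> \<in> borel_measurable torus"
    using assms(3) by (intro borel_measurable_torusI borel_measurable_continuous_onI)
  then show "(\<lambda>x. l2_rep u x * \<phi> x) \<in> borel_measurable torus" "(\<lambda>x. g x * \<phi> x) \<in> borel_measurable torus"
    using assms(2) borel_measurable_integrable[OF integrable_rep[of u]] by simp_all
  show "AE x in torus. l2_rep u x * \<phi> x = g x * \<phi> x"
    using assms(1) by eventually_elim simp
qed

lemma l2_fourier_class: "square_integrable f \<Longrightarrow> l2_fourier (l2_class f) k = fourier_coeff f k"
  unfolding l2_fourier_def fourier_coeff_def
  by (intro integral_rep_continuous_cong l2_rep_class continuous_intros) (auto simp: square_integrable_def)

lemma l2_fourier_add: "l2_fourier (u + v) k = l2_fourier u k + l2_fourier v k"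
proof -
  have "l2_fourier (u + v) k = (LINT x|torus. (l2_rep u x + l2_rep v x) * char (- k) x)"
    unfolding l2_fourier_def fourier_coeff_def
    using borel_measurable_integrable[OF integrable_rep]
    by (intro integral_rep_continuous_cong l2_rep_add continuous_intros borel_measurable_add)
  also have "\<dots> = l2_fourier u k + l2_fourier v k"
    unfolding l2_fourier_def fourier_coeff_def ring_distribs
    by (intro Bochner_Integration.integral_add integrable_torus_mult_continuous integrable_rep continuous_intros)
  finally show ?thesis .
qed

lemma l2_fourier_scale: "l2_fourier (l2_scale c u) k = c * l2_fourier u k"
proof -
  have "l2_fourier (l2_scale c u) k = (LINT x|torus. (c * l2_rep u x) * char (- k) x)"
    unfolding l2_fourier_def fourier_coeff_def
    using borel_measurable_integrable[OF integrable_rep]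
    by (intro integral_rep_continuous_cong l2_rep_scale continuous_intros borel_measurable_times borel_measurable_const)
  also have "\<dots> = c * l2_fourier u k"
    unfolding l2_fourier_def fourier_coeff_def by (simp add: mult.assoc)
  finally show ?thesis .
qed

lemma l2_fourier_zero: "l2_fourier 0 k = 0"
  using l2_fourier_add[of 0 0 k] by simp

lemma l2_fourier_sum: "l2_fourier (\<Sum>i\<in>A. f i) k = (\<Sum>i\<in>A. l2_fourier (f i) k)"
  by (induction A rule: infinite_finite_induct) (auto simp: l2_fourier_zero l2_fourier_add)

lemma fourier_coeff_char: "fourier_coeff (\<lambda>x. char l x) k = (if k = l then 1 else 0)"
  unfolding fourier_coeff_def using integral_char[of "l - k"] by (simp add: char_add[of l "- k", simplified])

lemma l2_fourier_class_char: "l2_fourier (l2_class (char l)) k = (if k = l then 1 else 0)"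
  by (subst l2_fourier_class) (auto intro!: square_integrable_continuous continuous_intros simp: fourier_coeff_char)

text \<open>The character of frequency \<open>- k\<close> is an admissible test function. It turns
  the distributional equation into multiplication of the \<open>k\<close>-th coefficient by
  \<open>- 4 * pi\<^sup>2 * |k|\<^sup>2\<close>, and a nonzero coefficient cancels.\<close>

lemma eigenfunction_fourier_support:
  assumes "eigenfunction h E u" "h > 0" "l2_fourier u k \<noteq> 0"
  shows "4 * pi\<^sup>2 * h\<^sup>2 * (norm (lattice_vec k))\<^sup>2 = E"
proof -
  obtain w where w: "has_laplacian u w" "l2_scale (of_real (- h\<^sup>2)) w = l2_scale (of_real E) u"
    using assms(1) by (auto simp: eigenfunction_def)
  have "(LINT x|torus. l2_rep u x * smooth_laplacian (char (- k)) x) = l2_fourier w k"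
    using w(1) torus_smooth_char unfolding has_laplacian_def l2_fourier_def fourier_coeff_def by blast
  also have "(LINT x|torus. l2_rep u x * smooth_laplacian (char (- k)) x)
      = (LINT x|torus. - of_real (4 * pi\<^sup>2 * (norm (lattice_vec k))\<^sup>2) * (l2_rep u x * char (- k) x))"
    by (simp add: smooth_laplacian_char lattice_vec_minus mult_ac)
  also have "\<dots> = - of_real (4 * pi\<^sup>2 * (norm (lattice_vec k))\<^sup>2) * l2_fourier u k"
    by (simp only: integral_mult_right_zero l2_fourier_def fourier_coeff_def)
  finally have "l2_fourier w k = - of_real (4 * pi\<^sup>2 * (norm (lattice_vec k))\<^sup>2) * l2_fourier u k" by simp
  moreover have "of_real (- h\<^sup>2) * l2_fourier w k = of_real E * l2_fourier u k"
    using arg_cong[OF w(2), of "\<lambda>v. l2_fourier v k"] by (simp only: l2_fourier_scale)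
  ultimately have "of_real (h\<^sup>2 * (4 * pi\<^sup>2 * (norm (lattice_vec k))\<^sup>2)) * l2_fourier u k = of_real E * l2_fourier u k"
    by (simp add: mult_ac)
  then have "complex_of_real (h\<^sup>2 * (4 * pi\<^sup>2 * (norm (lattice_vec k))\<^sup>2)) = of_real E"
    using assms(3) by (simp only: mult_cancel_right) simp
  then show ?thesis by (simp only: of_real_eq_iff mult_ac)
qed

lemma eigenfunction_char:
  assumes "h > 0"
  shows "eigenfunction h (4 * pi\<^sup>2 * h\<^sup>2 * (norm (lattice_vec k))\<^sup>2) (l2_class (char k))"
proof -
  let ?L = "4 * pi\<^sup>2 * (norm (lattice_vec k))\<^sup>2" and ?u = "l2_class (char k)"
  have sq: "square_integrable (char k)" by (intro square_integrable_continuous continuous_intros)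
  have meas: "char k \<in> borel_measurable torus" using sq by (simp add: square_integrable_def)
  have "?u \<noteq> 0" using l2_fourier_class_char[of k k] l2_fourier_zero[of k] by auto
  moreover have "has_laplacian ?u (l2_scale (of_real (- ?L)) ?u)"
    unfolding has_laplacian_def
  proof (intro allI impI)
    fix \<phi> :: "real^'a \<Rightarrow> complex" assume \<phi>: "torus_smooth \<phi>"
    have c: "continuous_on UNIV \<phi>" "continuous_on UNIV (smooth_laplacian \<phi>)"
      unfolding smooth_laplacian_def
      by (intro continuous_intros torus_smooth_continuous torus_smooth_partial_deriv \<phi>)+
    have "AE x in torus. l2_rep (l2_scale (of_real (- ?L)) ?u) x = of_real (- ?L) * char k x"
      using l2_rep_scale[of "of_real (- ?L)" ?u] l2_rep_class[OF sq] by eventually_elim simp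
    then have "(LINT x|torus. l2_rep (l2_scale (of_real (- ?L)) ?u) x * \<phi> x) = (LINT x|torus. (of_real (- ?L) * char k x) * \<phi> x)"
      using meas by (intro integral_rep_continuous_cong c) auto
    also have "\<dots> = - of_real ?L * (LINT x|torus. \<phi> x * char k x)"
      unfolding integral_mult_right_zero[symmetric] by (rule Bochner_Integration.integral_cong) (auto simp: mult_ac)
    also have "\<dots> = (LINT x|torus. char k x * smooth_laplacian \<phi> x)"
      by (rule integral_smooth_laplacian_char[OF \<phi>, symmetric])
    also have "\<dots> = (LINT x|torus. l2_rep ?u x * smooth_laplacian \<phi> x)"
      by (rule integral_rep_continuous_cong[OF l2_rep_class[OF sq] meas c(2), symmetric])
    finally show "(LINT x|torus. l2_rep ?u x * smooth_laplacian \<phi> x) = (LINT x|torus. l2_rep (l2_scale (of_real (- ?L)) ?u) x * \<phi> x)" ..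
  qed
  moreover have "l2_scale (of_real (- h\<^sup>2)) (l2_scale (of_real (- ?L)) ?u) = l2_scale (of_real (4 * pi\<^sup>2 * h\<^sup>2 * (norm (lattice_vec k))\<^sup>2)) ?u"
    by (simp add: mult_ac)
  ultimately show ?thesis unfolding eigenfunction_def by blast
qed

lemma mem_shell_iff:
  assumes "h > 0"
  shows "k \<in> shell (\<alpha> / (2 * pi)) (1 / (2 * pi * h)) \<longleftrightarrow>
    4 * pi\<^sup>2 * h\<^sup>2 * (norm (lattice_vec k))\<^sup>2 \<in> {1 - \<alpha> * h..1 + \<alpha> * h}"
proof -
  let ?q = "(norm (lattice_vec k))\<^sup>2"
  have p: "0 < 4 * pi\<^sup>2 * h\<^sup>2" using assms by simp
  have "k \<in> shell (\<alpha> / (2 * pi)) (1 / (2 * pi * h)) \<longleftrightarrow> \<bar>?q - (1 / (2 * pi * h))\<^sup>2\<bar> \<le> \<alpha> / (2 * pi) * (1 / (2 * pi * h))"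
    by (simp add: shell_def)
  also have "\<dots> \<longleftrightarrow> (4 * pi\<^sup>2 * h\<^sup>2) * \<bar>?q - (1 / (2 * pi * h))\<^sup>2\<bar> \<le> (4 * pi\<^sup>2 * h\<^sup>2) * (\<alpha> / (2 * pi) * (1 / (2 * pi * h)))"
    by (rule mult_le_cancel_left_pos[OF p, symmetric])
  also have "(4 * pi\<^sup>2 * h\<^sup>2) * (\<alpha> / (2 * pi) * (1 / (2 * pi * h))) = \<alpha> * h"
    using assms by (simp add: field_simps power2_eq_square)
  also have "(4 * pi\<^sup>2 * h\<^sup>2) * \<bar>?q - (1 / (2 * pi * h))\<^sup>2\<bar> = \<bar>(4 * pi\<^sup>2 * h\<^sup>2) * (?q - (1 / (2 * pi * h))\<^sup>2)\<bar>"
    using p by (metis abs_mult abs_of_pos)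
  also have "(4 * pi\<^sup>2 * h\<^sup>2) * (?q - (1 / (2 * pi * h))\<^sup>2) = 4 * pi\<^sup>2 * h\<^sup>2 * ?q - 1"
    using assms by (simp add: field_simps power2_eq_square)
  finally show ?thesis by (auto simp: abs_le_iff)
qed

text \<open>The characters with frequency in the shell are eigenfunctions in the spectral space, and
  their Fourier coefficients show them to be independent; the space is spanned by \<open>N\<close>
  vectors.\<close>

lemma card_shell_le_eigenbasis:
  fixes \<psi> :: "nat \<Rightarrow> 'n::finite l2"
  assumes "eigenbasis \<alpha> h N \<psi>" "h > 0" "\<alpha> > 0"
  shows "card (shell (\<alpha> / (2 * pi)) (1 / (2 * pi * h)) :: (int ^ 'n) set) \<le> N"
proof -
  define K :: "(int ^ 'n) set" where "K = shell (\<alpha> / (2 * pi)) (1 / (2 * pi * h))"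
  define e :: "int ^ 'n \<Rightarrow> 'n l2" where "e k = l2_class (char k)" for k
  have fin: "finite K" unfolding K_def using assms by (intro finite_shell) auto
  have fe: "l2_fourier (e l) k = (if k = l then 1 else 0)" for l k
    unfolding e_def by (rule l2_fourier_class_char)
  have inj: "inj_on e K"
  proof (rule inj_onI)
    fix k l assume "e k = e l" then show "k = l" using fe[of k k] fe[of l k] by (auto split: if_splits)
  qed
  have "l2.independent (e ` K)"
  proof
    assume "l2.dependent (e ` K)"
    then obtain c k where k: "k \<in> K" "c (e k) \<noteq> 0" and s: "(\<Sum>v\<in>e ` K. l2_scale (c v) v) = 0"
      using fin by (auto simp: l2.dependent_finite)
    have "0 = l2_fourier (\<Sum>l\<in>K. l2_scale (c (e l)) (e l)) k"
      using s by (simp add: sum.reindex[OF inj] l2_fourier_zero)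
    also have "\<dots> = (\<Sum>l\<in>K. c (e l) * (if k = l then 1 else 0))" by (simp add: l2_fourier_sum l2_fourier_scale fe)
    also have "\<dots> = (\<Sum>l\<in>K. if l = k then c (e l) else 0)" by (intro sum.cong) auto
    also have "\<dots> = c (e k)" using k(1) fin by (simp add: sum.delta)
    finally show False using k by simp
  qed
  moreover have "e ` K \<subseteq> l2.span (\<psi> ` {1..N})"
  proof -
    have "e ` K \<subseteq> spectral_space \<alpha> h"
      unfolding spectral_space_def
    proof clarify
      fix k assume "k \<in> K"
      then have "4 * pi\<^sup>2 * h\<^sup>2 * (norm (lattice_vec k))\<^sup>2 \<in> {1 - \<alpha> * h..1 + \<alpha> * h}"
        unfolding K_def using mem_shell_iff[OF assms(2)] by blast
      then show "e k \<in> l2.span {u. \<exists>E\<in>{1 - \<alpha> * h..1 + \<alpha> * h}. eigenfunction h E u}"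
        using eigenfunction_char[OF assms(2), of k] unfolding e_def by (intro l2.span_base) blast
    qed
    then show ?thesis using assms(1) by (simp add: eigenbasis_def)
  qed
  ultimately have "card (e ` K) \<le> card (\<psi> ` {1..N})"
    using l2.independent_span_bound[of "\<psi> ` {1..N}" "e ` K"] by simp
  also have "\<dots> \<le> N" using card_image_le[of "{1..N}" \<psi>] by simp
  finally show ?thesis using inj by (simp add: card_image K_def)
qed

text \<open>Subtracting the finite sum leaves an integrable function without Fourier coefficients.
  This is where completeness of the characters enters.\<close>

lemma l2_rep_fourier_expansion:
  assumes "finite K" "\<And>k. k \<notin> K \<Longrightarrow> l2_fourier u k = 0"
  shows "AE x in torus. l2_rep u x = (\<Sum>k\<in>K. l2_fourier u k * char k x)"
proof -
  define p where "p x = (\<Sum>k\<in>K. l2_fourier u k * char k x)" for x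
  have p: "continuous_on UNIV p" unfolding p_def by (intro continuous_intros)
  have "AE x in torus. l2_rep u x - p x = 0"
  proof (rule fourier_coeff_eq_0_imp_AE_eq_0)
    show "integrable torus (\<lambda>x. l2_rep u x - p x)"
      by (intro Bochner_Integration.integrable_diff integrable_rep integrable_torus_continuous p)
    fix k
    have "fourier_coeff p k = (LINT x|torus. (\<Sum>l\<in>K. l2_fourier u l * (char l x * char (- k) x)))"
      by (simp add: fourier_coeff_def p_def sum_distrib_right mult.assoc)
    also have "\<dots> = (\<Sum>l\<in>K. LINT x|torus. l2_fourier u l * (char l x * char (- k) x))"
      by (intro Bochner_Integration.integral_sum integrable_torus_continuous continuous_intros)
    also have "\<dots> = (\<Sum>l\<in>K. l2_fourier u l * (if k = l then 1 else 0))"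
      by (simp only: integral_mult_right_zero fourier_coeff_char[unfolded fourier_coeff_def])
    also have "\<dots> = (\<Sum>l\<in>K. if l = k then l2_fourier u l else 0)" by (intro sum.cong) auto
    also have "\<dots> = l2_fourier u k" using assms by (simp add: sum.delta)
    finally have "fourier_coeff p k = l2_fourier u k" .
    moreover have "fourier_coeff (\<lambda>x. l2_rep u x - p x) k = fourier_coeff (l2_rep u) k - fourier_coeff p k"
      unfolding fourier_coeff_def left_diff_distrib
      by (intro Bochner_Integration.integral_diff integrable_torus_mult_continuous integrable_rep
          integrable_torus_continuous p continuous_intros)
    ultimately show "fourier_coeff (\<lambda>x. l2_rep u x - p x) k = 0" by (simp add: l2_fourier_def)
  qed
  then show ?thesis by (simp add: p_def)
qed

text \<open>The formula serves twice: with \<open>a\<close> equal to 1 it gives the inner product,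
  and with \<open>u = v\<close> the integral of \<open>a\<close> against the density of an
  eigenfunction.\<close>

lemma integral_rep_mult_cnj_rep:
  fixes u v :: "'n::finite l2"
  assumes K: "finite K" and u: "\<And>k. k \<notin> K \<Longrightarrow> l2_fourier u k = 0" and v: "\<And>k. k \<notin> K \<Longrightarrow> l2_fourier v k = 0"
    and a: "continuous_on UNIV a"
  shows "(LINT x|torus. a x * (l2_rep u x * cnj (l2_rep v x))) =
    (\<Sum>k\<in>K. \<Sum>l\<in>K. l2_fourier u k * cnj (l2_fourier v l) * fourier_coeff a (l - k))"
proof -
  let ?p = "\<lambda>u x. \<Sum>k\<in>K. l2_fourier u k * char k x"
  have pc: "continuous_on UNIV (?p w)" for w by (intro continuous_intros)
  have am: "a \<in> borel_measurable torus" using a by (intro borel_measurable_torusI borel_measurable_continuous_onI)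
  have "(LINT x|torus. a x * (l2_rep u x * cnj (l2_rep v x))) = (LINT x|torus. a x * (?p u x * cnj (?p v x)))"
  proof (rule integral_cong_AE)
    have cnjm: "cnj \<in> borel_measurable borel" by (intro borel_measurable_continuous_onI continuous_intros)
    show "(\<lambda>x. a x * (l2_rep u x * cnj (l2_rep v x))) \<in> borel_measurable torus"
      using am borel_measurable_integrable[OF integrable_rep] measurable_compose[OF _ cnjm]
      by (intro borel_measurable_times) auto
    show "(\<lambda>x. a x * (?p u x * cnj (?p v x))) \<in> borel_measurable torus"
      by (intro borel_measurable_torusI borel_measurable_continuous_onI continuous_intros a)
    show "AE x in torus. a x * (l2_rep u x * cnj (l2_rep v x)) = a x * (?p u x * cnj (?p v x))"
    proof -
      have "AE x in torus. l2_rep u x = ?p u x" "AE x in torus. l2_rep v x = ?p v x"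
        by (rule l2_rep_fourier_expansion[OF K]; fact u v)+
      then show ?thesis by eventually_elim simp
    qed
  qed
  also have "\<dots> = (LINT x|torus. (\<Sum>k\<in>K. \<Sum>l\<in>K. (l2_fourier u k * cnj (l2_fourier v l)) * (a x * char (- (l - k)) x)))"
  proof (rule Bochner_Integration.integral_cong[OF refl])
    fix x
    have "a x * (?p u x * cnj (?p v x)) = (\<Sum>k\<in>K. \<Sum>l\<in>K. a x * ((l2_fourier u k * char k x) * cnj (l2_fourier v l * char l x)))"
      by (simp only: cnj_sum sum_product) (simp only: sum_distrib_left)
    also have "\<dots> = (\<Sum>k\<in>K. \<Sum>l\<in>K. (l2_fourier u k * cnj (l2_fourier v l)) * (a x * char (- (l - k)) x))"
    proof (intro sum.cong refl)
      fix k l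
      show "a x * ((l2_fourier u k * char k x) * cnj (l2_fourier v l * char l x)) = (l2_fourier u k * cnj (l2_fourier v l)) * (a x * char (- (l - k)) x)"
        using char_diff[of k l x] by (simp add: mult_ac)
    qed
    finally show "a x * (?p u x * cnj (?p v x)) = (\<Sum>k\<in>K. \<Sum>l\<in>K. (l2_fourier u k * cnj (l2_fourier v l)) * (a x * char (- (l - k)) x))" .
  qed
  also have "\<dots> = (\<Sum>k\<in>K. LINT x|torus. (\<Sum>l\<in>K. (l2_fourier u k * cnj (l2_fourier v l)) * (a x * char (- (l - k)) x)))"
    by (intro Bochner_Integration.integral_sum integrable_torus_continuous continuous_intros a)
  also have "\<dots> = (\<Sum>k\<in>K. \<Sum>l\<in>K. LINT x|torus. (l2_fourier u k * cnj (l2_fourier v l)) * (a x * char (- (l - k)) x))"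
    by (intro sum.cong refl Bochner_Integration.integral_sum integrable_torus_continuous continuous_intros a)
  also have "\<dots> = (\<Sum>k\<in>K. \<Sum>l\<in>K. l2_fourier u k * cnj (l2_fourier v l) * fourier_coeff a (l - k))"
    by (simp only: integral_mult_right_zero fourier_coeff_def)
  finally show ?thesis .
qed

lemma l2_inner_fourier:
  assumes K: "finite K" and u: "\<And>k. k \<notin> K \<Longrightarrow> l2_fourier u k = 0" and v: "\<And>k. k \<notin> K \<Longrightarrow> l2_fourier v k = 0"
  shows "l2_inner u v = (\<Sum>k\<in>K. l2_fourier u k * cnj (l2_fourier v k))"
proof -
  have 1: "fourier_coeff (\<lambda>x. 1) m = (if m = 0 then 1 else 0)" for m :: "int ^ 'a"
    unfolding fourier_coeff_def using integral_char[of "- m"] by simp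
  have "l2_inner u v = (LINT x|torus. 1 * (l2_rep u x * cnj (l2_rep v x)))" by (simp add: l2_inner_def)
  also have "\<dots> = (\<Sum>k\<in>K. \<Sum>l\<in>K. l2_fourier u k * cnj (l2_fourier v l) * fourier_coeff (\<lambda>x. 1) (l - k))"
    by (intro integral_rep_mult_cnj_rep assms continuous_intros)
  also have "\<dots> = (\<Sum>k\<in>K. \<Sum>l\<in>K. if l = k then l2_fourier u k * cnj (l2_fourier v l) else 0)"
    by (intro sum.cong refl) (simp add: 1)
  finally show ?thesis using K by (simp add: sum.delta)
qed

section \<open>Correlations of orthonormal families and decay of coefficients\<close>

text \<open>
  Bessel's inequality for the \<open>k\<close>-th unit vector: its projection \<open>v\<close> satisfies \<open>|v|\<^sup>2 = v\<^sub>k\<close>.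
\<close>

lemma orthonormal_column_sum_le_1:
  fixes c :: "'j \<Rightarrow> 'k \<Rightarrow> complex"
  assumes J: "finite J" and K: "finite K" "k \<in> K"
    and orth: "\<And>i j. i \<in> J \<Longrightarrow> j \<in> J \<Longrightarrow> (\<Sum>l\<in>K. c i l * cnj (c j l)) = (if i = j then 1 else 0)"
  shows "(\<Sum>j\<in>J. (cmod (c j k))\<^sup>2) \<le> 1"
proof -
  define s where "s = (\<Sum>j\<in>J. (cmod (c j k))\<^sup>2)"
  define v where "v l = (\<Sum>j\<in>J. cnj (c j k) * c j l)" for l
  have vk: "v k = of_real s"
    by (simp only: v_def s_def of_real_sum complex_norm_square mult.commute)
  have "complex_of_real (\<Sum>l\<in>K. (cmod (v l))\<^sup>2) = (\<Sum>l\<in>K. v l * cnj (v l))"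
    by (simp only: of_real_sum complex_norm_square)
  also have "\<dots> = (\<Sum>l\<in>K. \<Sum>i\<in>J. \<Sum>j\<in>J. (cnj (c i k) * c j k) * (c i l * cnj (c j l)))"
    by (simp add: v_def sum_product mult_ac)
  also have "\<dots> = (\<Sum>i\<in>J. \<Sum>l\<in>K. \<Sum>j\<in>J. (cnj (c i k) * c j k) * (c i l * cnj (c j l)))"
    by (rule sum.swap)
  also have "\<dots> = (\<Sum>i\<in>J. \<Sum>j\<in>J. \<Sum>l\<in>K. (cnj (c i k) * c j k) * (c i l * cnj (c j l)))"
    by (intro sum.cong refl sum.swap)
  also have "\<dots> = (\<Sum>i\<in>J. \<Sum>j\<in>J. if j = i then cnj (c i k) * c j k else 0)"
    by (intro sum.cong refl) (simp add: orth flip: sum_distrib_left)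
  also have "\<dots> = (\<Sum>i\<in>J. cnj (c i k) * c i k)" using J by (simp add: sum.delta)
  also have "\<dots> = complex_of_real s" by (simp only: s_def of_real_sum complex_norm_square mult.commute)
  finally have sv: "(\<Sum>l\<in>K. (cmod (v l))\<^sup>2) = s" by (simp only: of_real_eq_iff)
  have "(cmod (v k))\<^sup>2 \<le> (\<Sum>l\<in>K. (cmod (v l))\<^sup>2)"
    using K by (intro member_le_sum) auto
  then have "s * s \<le> s * 1" using sv vk by (simp add: power2_eq_square)
  moreover have "s \<ge> 0" unfolding s_def by (simp add: sum_nonneg)
  ultimately show ?thesis unfolding s_def[symmetric]
    by (cases "s = 0") (auto simp: mult_le_cancel_left)
qed

text \<open>In the Cauchy-Schwarz inequality the shifted factor is at most 1 by normalisation. The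
  unshifted factor is kept and summed over \<open>j\<close>, which by Bessel costs at most 1 for
  each \<open>k \<in> S\<close>.\<close>

lemma sum_shifted_correlation_le_card:
  fixes c :: "'j \<Rightarrow> int ^ 'n::finite \<Rightarrow> complex"
  assumes J: "finite J" and K: "finite K"
    and orth: "\<And>i j. i \<in> J \<Longrightarrow> j \<in> J \<Longrightarrow> (\<Sum>l\<in>K. c i l * cnj (c j l)) = (if i = j then 1 else 0)"
    and S: "S \<subseteq> K" "(\<lambda>k. k + m) ` S \<subseteq> K"
  shows "(\<Sum>j\<in>J. (cmod (\<Sum>k\<in>S. c j k * cnj (c j (k + m))))\<^sup>2) \<le> real (card S)"
proof -
  have fS: "finite S" using S K finite_subset by blast
  have each: "(cmod (\<Sum>k\<in>S. c j k * cnj (c j (k + m))))\<^sup>2 \<le> (\<Sum>k\<in>S. (cmod (c j k))\<^sup>2)" if j: "j \<in> J" for j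
  proof -
    have "complex_of_real (\<Sum>l\<in>K. (cmod (c j l))\<^sup>2) = 1"
      using orth[OF j j] by (simp only: of_real_sum complex_norm_square if_True refl)
    then have 1: "(\<Sum>l\<in>K. (cmod (c j l))\<^sup>2) = 1" by (simp only: of_real_eq_1_iff)
    have "(\<Sum>k\<in>S. (cmod (c j (k + m)))\<^sup>2) = (\<Sum>l\<in>(\<lambda>k. k + m) ` S. (cmod (c j l))\<^sup>2)"
      by (subst sum.reindex) (auto simp: inj_on_def)
    also have "\<dots> \<le> (\<Sum>l\<in>K. (cmod (c j l))\<^sup>2)" using K S by (intro sum_mono2) auto
    finally have 2: "(\<Sum>k\<in>S. (cmod (c j (k + m)))\<^sup>2) \<le> 1" using 1 by simp
    have "cmod (\<Sum>k\<in>S. c j k * cnj (c j (k + m))) \<le> (\<Sum>k\<in>S. cmod (c j k) * cmod (c j (k + m)))"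
      by (rule order_trans[OF norm_sum]) (simp add: norm_mult)
    then have "(cmod (\<Sum>k\<in>S. c j k * cnj (c j (k + m))))\<^sup>2 \<le> (\<Sum>k\<in>S. cmod (c j k) * cmod (c j (k + m)))\<^sup>2"
      by (intro power_mono) auto
    also have "\<dots> \<le> (\<Sum>k\<in>S. (cmod (c j k))\<^sup>2) * (\<Sum>k\<in>S. (cmod (c j (k + m)))\<^sup>2)"
      by (rule Cauchy_Schwarz_ineq_sum)
    also have "\<dots> \<le> (\<Sum>k\<in>S. (cmod (c j k))\<^sup>2) * 1" using 2 by (intro mult_left_mono sum_nonneg) auto
    finally show ?thesis by simp
  qed
  have "(\<Sum>j\<in>J. (cmod (\<Sum>k\<in>S. c j k * cnj (c j (k + m))))\<^sup>2) \<le> (\<Sum>j\<in>J. \<Sum>k\<in>S. (cmod (c j k))\<^sup>2)"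
    by (intro sum_mono each)
  also have "\<dots> = (\<Sum>k\<in>S. \<Sum>j\<in>J. (cmod (c j k))\<^sup>2)" by (rule sum.swap)
  also have "\<dots> \<le> (\<Sum>k\<in>S. 1)"
    using S by (intro sum_mono orthonormal_column_sum_le_1[OF J K _ orth]) auto
  finally show ?thesis by simp
qed

text \<open>The double sum is grouped by \<open>m = l - k\<close>, and the diagonal
  \<open>m = 0\<close> is what gets subtracted. The relation \<open>P\<close> holds between any two
  frequencies carrying nonzero coefficients, so the terms violating it vanish and the inner sums may
  be restricted.\<close>

lemma quadratic_form_by_difference:
  fixes c :: "int ^ 'n::finite \<Rightarrow> complex" and b :: "int ^ 'n \<Rightarrow> complex"
  assumes K: "finite K" and shell: "\<And>k l. c k \<noteq> 0 \<Longrightarrow> c l \<noteq> 0 \<Longrightarrow> P k l"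
  shows "(\<Sum>k\<in>K. \<Sum>l\<in>K. c k * cnj (c l) * b (l - k)) - b 0 * (\<Sum>k\<in>K. c k * cnj (c k)) =
    (\<Sum>m\<in>(\<lambda>(k, l). l - k) ` (K \<times> K) - {0}. b m * (\<Sum>k\<in>{k \<in> K. k + m \<in> K \<and> P (k + m) k}. c k * cnj (c (k + m))))"
proof -
  define M where "M = (\<lambda>(k, l). l - k) ` (K \<times> K)"
  define B where "B m = (\<Sum>k\<in>{k \<in> K. k + m \<in> K}. c k * cnj (c (k + m)))" for m
  have M: "finite M" using K by (simp add: M_def)
  have "(\<Sum>k\<in>K. \<Sum>l\<in>K. c k * cnj (c l) * b (l - k)) = (\<Sum>(k, l)\<in>K \<times> K. c k * cnj (c l) * b (l - k))"
    by (rule sum.cartesian_product)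
  also have "\<dots> = (\<Sum>m\<in>M. \<Sum>(k, l)\<in>{p \<in> K \<times> K. (\<lambda>(k, l). l - k) p = m}. c k * cnj (c l) * b (l - k))"
    unfolding M_def by (rule sum.group[symmetric]) (use K in auto)
  also have "\<dots> = (\<Sum>m\<in>M. b m * B m)"
  proof (rule sum.cong[OF refl])
    fix m
    have "{p \<in> K \<times> K. (\<lambda>(k, l). l - k) p = m} = (\<lambda>k. (k, k + m)) ` {k \<in> K. k + m \<in> K}"
      by (auto simp: image_iff algebra_simps)
    moreover have "inj_on (\<lambda>k. (k, k + m)) {k \<in> K. k + m \<in> K}" by (auto simp: inj_on_def)
    ultimately have "(\<Sum>(k, l)\<in>{p \<in> K \<times> K. (\<lambda>(k, l). l - k) p = m}. c k * cnj (c l) * b (l - k)) = (\<Sum>k\<in>{k \<in> K. k + m \<in> K}. c k * cnj (c (k + m)) * b m)"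
      by (simp add: sum.reindex)
    then show "(\<Sum>(k, l)\<in>{p \<in> K \<times> K. (\<lambda>(k, l). l - k) p = m}. c k * cnj (c l) * b (l - k)) = b m * B m"
      by (simp add: B_def sum_distrib_left mult.commute)
  qed
  also have "\<dots> = b 0 * B 0 + (\<Sum>m\<in>M - {0}. b m * B m)"
  proof (cases "K = {}")
    case True
    then show ?thesis by (simp add: M_def B_def)
  next
    case False
    then have "0 \<in> M" by (force simp: M_def image_iff)
    then show ?thesis using M by (rule sum.remove[rotated])
  qed
  also have "B 0 = (\<Sum>k\<in>K. c k * cnj (c k))" by (simp add: B_def)
  finally have "(\<Sum>k\<in>K. \<Sum>l\<in>K. c k * cnj (c l) * b (l - k)) - b 0 * (\<Sum>k\<in>K. c k * cnj (c k)) = (\<Sum>m\<in>M - {0}. b m * B m)"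
    by simp
  also have "\<dots> = (\<Sum>m\<in>M - {0}. b m * (\<Sum>k\<in>{k \<in> K. k + m \<in> K \<and> P (k + m) k}. c k * cnj (c (k + m))))"
    unfolding B_def using K
    by (intro sum.cong refl arg_cong2[of _ _ _ _ "(*)"] sum.mono_neutral_right) (use shell in auto)
  finally show ?thesis by (simp add: M_def)
qed

text \<open>The correction term makes the induction telescope: the two new summands are at most
  \<open>4 / (L + 1) - 4 / (L + 2)\<close>.\<close>

lemma sum_inverse_square_le: "(\<Sum>t\<in>{- int L..int L}. 1 / (1 + (real_of_int t)\<^sup>2)) \<le> 5 - 4 / (real L + 1)"
proof (induction L)
  case 0
  then show ?case by simp
next
  case (Suc L)
  have "{- int (Suc L)..int (Suc L)} = insert (- int (Suc L)) (insert (int (Suc L)) {- int L..int L})" by auto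
  then have "(\<Sum>t\<in>{- int (Suc L)..int (Suc L)}. 1 / (1 + (real_of_int t)\<^sup>2)) =
      2 / (1 + (real L + 1)\<^sup>2) + (\<Sum>t\<in>{- int L..int L}. 1 / (1 + (real_of_int t)\<^sup>2))"
    by (simp add: power2_eq_square algebra_simps)
  also have "\<dots> \<le> 2 / (1 + (real L + 1)\<^sup>2) + (5 - 4 / (real L + 1))" using Suc.IH by simp
  also have "\<dots> \<le> 5 - 4 / (real (Suc L) + 1)"
  proof -
    have "2 / (1 + (real L + 1)\<^sup>2) \<le> 4 / ((real L + 1) * (real L + 2))"
      by (simp add: divide_simps power2_eq_square algebra_simps add_pos_nonneg)
    also have "\<dots> = 4 / (real L + 1) - 4 / (real L + 2)" by (simp add: field_simps)
    also have "real L + 2 = real (Suc L) + 1" by simp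
    finally show ?thesis by linarith
  qed
  finally show ?case .
qed

text \<open>The weight is a product over coordinates, so on a box containing \<open>F\<close> the
  sum factors into one-dimensional sums, each at most 5.\<close>

lemma sum_lattice_weight_le:
  fixes F :: "(int ^ 'n::finite) set"
  assumes "finite F"
  shows "(\<Sum>m\<in>F. \<Prod>i\<in>UNIV. 1 / (1 + (real_of_int (m $ i))\<^sup>2)) \<le> 5 ^ CARD('n)"
proof -
  define w where "w t = 1 / (1 + (real_of_int t)\<^sup>2)" for t
  have w: "w t \<ge> 0" for t by (simp add: w_def)
  define L where "L = nat (\<Sum>m\<in>F. \<Sum>i\<in>UNIV. \<bar>m $ i\<bar>)"
  have L: "\<bar>m $ i\<bar> \<le> int L" if "m \<in> F" for m i
  proof -
    have "\<bar>m $ i\<bar> \<le> (\<Sum>i\<in>UNIV. \<bar>m $ i\<bar>)" by (rule member_le_sum) auto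
    also have "\<dots> \<le> (\<Sum>m\<in>F. \<Sum>i\<in>UNIV. \<bar>m $ i\<bar>)"
      using assms that by (intro member_le_sum[of m F "\<lambda>m. \<Sum>i\<in>UNIV. \<bar>m $ i\<bar>"]) (auto intro: sum_nonneg)
    finally show ?thesis unfolding L_def by (rule order_trans) simp
  qed
  let ?I = "{- int L..int L}"
  have "(\<Sum>m\<in>F. \<Prod>i\<in>UNIV. w (m $ i)) \<le> (\<Sum>m\<in>{m :: int ^ 'n. \<forall>i. m $ i \<in> ?I}. \<Prod>i\<in>UNIV. w (m $ i))"
  proof (rule sum_mono2)
    show "finite {m :: int ^ 'n. \<forall>i. m $ i \<in> ?I}" by (rule finite_int_box) simp
    show "F \<subseteq> {m. \<forall>i. m $ i \<in> ?I}" using L by (auto simp: abs_le_iff minus_le_iff)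
  qed (auto intro!: prod_nonneg w)
  also have "\<dots> = (\<Sum>g\<in>Pi\<^sub>E (UNIV :: 'n set) (\<lambda>_. ?I). \<Prod>i\<in>UNIV. w (g i))"
    unfolding int_box_eq_image by (subst sum.reindex) (auto simp: inj_on_def vec_lambda_inject)
  also have "\<dots> = (\<Prod>i\<in>(UNIV :: 'n set). sum w ?I)" by (rule prod_sum_PiE[symmetric]) auto
  also have "\<dots> = (sum w ?I) ^ CARD('n)" by simp
  also have "\<dots> \<le> 5 ^ CARD('n)"
  proof (intro power_mono)
    have "4 / (real L + 1) \<ge> 0" by simp
    then show "sum w ?I \<le> 5" using sum_inverse_square_le[of L] unfolding w_def by linarith
  qed (auto intro: sum_nonneg w)
  finally show ?thesis by (simp add: w_def)
qed

text \<open>Let \<open>M\<close> be the largest coordinate of \<open>m\<close> in absolute value.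
  Then \<open>|m|\<^sup>2 \<le> d * M\<^sup>2\<close>, and the inverse of the summable weight is at
  most \<open>(2 * M\<^sup>2) ^ d\<close>; decay of order \<open>2 * d + 2\<close> in that
  coordinate pays for both. Its index depends on \<open>m\<close>, so \<open>C\<close> contains the
  sum of all \<open>B i\<close>.\<close>

lemma fourier_coeff_weighted_sum_bounded:
  fixes a :: "real ^ 'n::finite \<Rightarrow> complex"
  assumes "torus_smooth a"
  shows "\<exists>A>0. \<forall>F. finite F \<longrightarrow> 0 \<notin> F \<longrightarrow>
    (\<Sum>m\<in>F. cmod (fourier_coeff a m) * (norm (lattice_vec m))\<^sup>2) \<le> A"
proof -
  define d where "d = CARD('n)"
  obtain B where B: "\<And>i. B i > 0" 
    "\<And>i k. \<bar>real_of_int (k $ i)\<bar> ^ (2 * d + 2) * cmod (fourier_coeff a k) \<le> B i"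
    using fourier_coeff_decay[OF assms, of _ "2 * d + 2"] by metis
  define C where "C = real d * 2 ^ d * (\<Sum>i\<in>UNIV. B i)"
  have C: "C > 0" unfolding C_def d_def using B(1) by (intro mult_pos_pos sum_pos) auto
  have pt: "cmod (fourier_coeff a m) * (norm (lattice_vec m))\<^sup>2 \<le> C * (\<Prod>i\<in>UNIV. 1 / (1 + (real_of_int (m $ i))\<^sup>2))"
    if m: "m \<noteq> 0" for m
  proof -
    have "finite (range (\<lambda>i. \<bar>m $ i\<bar>))" "range (\<lambda>i. \<bar>m $ i\<bar>) \<noteq> {}" by auto
    then have "Max (range (\<lambda>i. \<bar>m $ i\<bar>)) \<in> range (\<lambda>i. \<bar>m $ i\<bar>)" by (rule Max_in)
    then obtain i where i: "Max (range (\<lambda>i. \<bar>m $ i\<bar>)) = \<bar>m $ i\<bar>" by blast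
    have max: "\<bar>m $ j\<bar> \<le> \<bar>m $ i\<bar>" for j unfolding i[symmetric] by (rule Max_ge) auto
    define M where "M = \<bar>real_of_int (m $ i)\<bar>"
    have jM: "(real_of_int (m $ j))\<^sup>2 \<le> M\<^sup>2" for j
    proof -
      have "\<bar>real_of_int (m $ j)\<bar> \<le> \<bar>real_of_int (m $ i)\<bar>" using max[of j] by (metis of_int_abs of_int_le_iff)
      then show ?thesis by (simp add: M_def abs_le_square_iff)
    qed
    have "m $ i \<noteq> 0" using max m by (auto simp: vec_eq_iff)
    then have M1: "M \<ge> 1" by (simp add: M_def)
    have nrm: "(norm (lattice_vec m))\<^sup>2 \<le> real d * M\<^sup>2"
    proof -
      have "(norm (lattice_vec m))\<^sup>2 \<le> (\<Sum>j\<in>(UNIV :: 'n set). M\<^sup>2)"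
        unfolding norm_lattice_vec by (intro sum_mono jM)
      then show ?thesis by (simp add: d_def)
    qed
    define W where "W = (\<Prod>i\<in>UNIV. 1 + (real_of_int (m $ i))\<^sup>2)"
    have W: "W > 0" unfolding W_def by (intro prod_pos) (auto intro: add_pos_nonneg)
    have "W \<le> (\<Prod>i\<in>(UNIV :: 'n set). 2 * M\<^sup>2)" unfolding W_def
    proof (intro prod_mono conjI)
      fix j show "1 + (real_of_int (m $ j))\<^sup>2 \<le> 2 * M\<^sup>2"
        using jM[of j] one_le_power[OF M1, of 2] by linarith
    qed auto
    also have "\<dots> = 2 ^ d * M ^ (2 * d)" by (simp add: d_def power_mult_distrib power_mult)
    finally have WM: "W \<le> 2 ^ d * M ^ (2 * d)" .
    have "cmod (fourier_coeff a m) * ((norm (lattice_vec m))\<^sup>2 * W) \<le> cmod (fourier_coeff a m) * ((real d * M\<^sup>2) * (2 ^ d * M ^ (2 * d)))"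
      using W by (intro mult_left_mono mult_mono nrm WM) auto
    also have "\<dots> = real d * 2 ^ d * (M ^ (2 * d + 2) * cmod (fourier_coeff a m))"
      by (simp add: power_add power2_eq_square)
    also have "\<dots> \<le> real d * 2 ^ d * B i" using B(2)[of m i] unfolding M_def by (intro mult_left_mono) auto
    also have "\<dots> \<le> C" unfolding C_def using B(1) by (intro mult_left_mono member_le_sum) (auto intro: less_imp_le)
    finally have "cmod (fourier_coeff a m) * (norm (lattice_vec m))\<^sup>2 \<le> C * (1 / W)"
      using W by (simp add: field_simps)
    also have "1 / W = (\<Prod>i\<in>UNIV. 1 / (1 + (real_of_int (m $ i))\<^sup>2))" by (simp add: W_def prod_dividef)
    finally show ?thesis .
  qed
  have "(\<Sum>m\<in>F. cmod (fourier_coeff a m) * (norm (lattice_vec m))\<^sup>2) \<le> C * 5 ^ d" if F: "finite F" "0 \<notin> F" for F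
  proof -
    have "(\<Sum>m\<in>F. cmod (fourier_coeff a m) * (norm (lattice_vec m))\<^sup>2) \<le> (\<Sum>m\<in>F. C * (\<Prod>i\<in>UNIV. 1 / (1 + (real_of_int (m $ i))\<^sup>2)))"
      using F by (intro sum_mono pt) auto
    also have "\<dots> \<le> C * 5 ^ d" unfolding sum_distrib_left[symmetric] d_def
      using C by (intro mult_left_mono sum_lattice_weight_le F) auto
    finally show ?thesis .
  qed
  then show ?thesis using C by (intro exI[of _ "C * 5 ^ d"]) auto
qed

text \<open>Splitting \<open>|b m|\<close> into two square roots makes it a weight in both factors,
  so the quadratic quantities \<open>|z m|\<^sup>2\<close> can afterwards be summed over
  \<open>j\<close> for each \<open>m\<close> separately.\<close>

lemma cmod_sum_mult_squared_le:
  fixes b z :: "'a \<Rightarrow> complex"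
  shows "(cmod (\<Sum>m\<in>M. b m * z m))\<^sup>2 \<le> (\<Sum>m\<in>M. cmod (b m)) * (\<Sum>m\<in>M. cmod (b m) * (cmod (z m))\<^sup>2)"
proof -
  have "cmod (\<Sum>m\<in>M. b m * z m) \<le> (\<Sum>m\<in>M. cmod (b m * z m))" by (rule norm_sum)
  also have "\<dots> = (\<Sum>m\<in>M. sqrt (cmod (b m)) * (sqrt (cmod (b m)) * cmod (z m)))"
    by (simp add: norm_mult flip: mult.assoc)
  finally have "(cmod (\<Sum>m\<in>M. b m * z m))\<^sup>2 \<le> (\<Sum>m\<in>M. sqrt (cmod (b m)) * (sqrt (cmod (b m)) * cmod (z m)))\<^sup>2"
    by (intro power_mono) auto
  also have "\<dots> \<le> (\<Sum>m\<in>M. (sqrt (cmod (b m)))\<^sup>2) * (\<Sum>m\<in>M. (sqrt (cmod (b m)) * cmod (z m))\<^sup>2)"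
    by (rule Cauchy_Schwarz_ineq_sum)
  finally show ?thesis by (simp add: power_mult_distrib)
qed

section \<open>The variance estimate\<close>

lemma eigenbasis_fourier:
  assumes \<psi>: "eigenbasis \<alpha> h N \<psi>" and h: "h > 0" and j: "j \<in> {1..N}"
  shows "k \<notin> shell (\<alpha> / (2 * pi)) (1 / (2 * pi * h)) \<Longrightarrow> l2_fourier (\<psi> j) k = 0"
    and "l2_fourier (\<psi> j) k \<noteq> 0 \<Longrightarrow> l2_fourier (\<psi> j) l \<noteq> 0 \<Longrightarrow> norm (lattice_vec k) = norm (lattice_vec l)"
proof -
  obtain E where E: "E \<in> {1 - \<alpha> * h..1 + \<alpha> * h}" "eigenfunction h E (\<psi> j)"
    using \<psi> j unfolding eigenbasis_def by blast
  note supp = eigenfunction_fourier_support[OF E(2) h]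
  show "l2_fourier (\<psi> j) k = 0" if "k \<notin> shell (\<alpha> / (2 * pi)) (1 / (2 * pi * h))"
    using that supp[of k] E(1) unfolding mem_shell_iff[OF h] by blast
  assume "l2_fourier (\<psi> j) k \<noteq> 0" "l2_fourier (\<psi> j) l \<noteq> 0"
  then have "4 * pi\<^sup>2 * h\<^sup>2 * (norm (lattice_vec k))\<^sup>2 = 4 * pi\<^sup>2 * h\<^sup>2 * (norm (lattice_vec l))\<^sup>2"
    using supp by metis
  then have "(norm (lattice_vec k))\<^sup>2 = (norm (lattice_vec l))\<^sup>2" using h by simp
  then show "norm (lattice_vec k) = norm (lattice_vec l)" by (rule power2_eq_imp_eq) auto
qed

text \<open>One factor \<open>A\<close> bounds the sum of \<open>|b m|\<close>, as
  \<open>|m| \<ge> 1\<close>; the other bounds the sum weighted by \<open>|m|\<^sup>2\<close>, the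
  growth allowed to the slices.\<close>

lemma eigenbasis_variance_le:
  fixes \<psi> :: "nat \<Rightarrow> 'n::finite l2"
  assumes \<psi>: "eigenbasis \<alpha> h N \<psi>" and h: "h > 0" and \<alpha>: "\<alpha> > 0" and a: "torus_smooth a"
    and A: "\<And>F. finite F \<Longrightarrow> 0 \<notin> F \<Longrightarrow> (\<Sum>m\<in>F. cmod (fourier_coeff a m) * (norm (lattice_vec m))\<^sup>2) \<le> A"
    and T: "T \<ge> 0" "\<And>m :: int ^ 'n. m \<noteq> 0 \<Longrightarrow>
      real (card (shell_slice (\<alpha> / (2 * pi)) (1 / (2 * pi * h)) m)) \<le> T * (norm (lattice_vec m))\<^sup>2"
  shows "(\<Sum>j=1..N. (cmod ((LINT x|torus. a x * of_real ((cmod (l2_rep (\<psi> j) x))\<^sup>2)) - (LINT x|torus. a x)))\<^sup>2)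
    \<le> A * A * T"
proof -
  define K :: "(int ^ 'n) set" where "K = shell (\<alpha> / (2 * pi)) (1 / (2 * pi * h))"
  define c where "c j = l2_fourier (\<psi> j)" for j
  define b where "b = fourier_coeff a"
  define P where "P k l \<longleftrightarrow> norm (lattice_vec k) = norm (lattice_vec l)" for k l :: "int ^ 'n"
  define S where "S m = {k \<in> K. k + m \<in> K \<and> P (k + m) k}" for m
  define M where "M = (\<lambda>(k, l). l - k) ` (K \<times> K) - {0}"
  define B where "B j m = (\<Sum>k\<in>S m. c j k * cnj (c j (k + m)))" for j m
  have K: "finite K" unfolding K_def using h \<alpha> by (intro finite_shell) auto
  have M: "finite M" "0 \<notin> M" using K by (auto simp: M_def)
  have supp: "c j k = 0" if "j \<in> {1..N}" "k \<notin> K" for j k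
    using eigenbasis_fourier(1)[OF \<psi> h that(1)] that(2) by (simp add: c_def K_def)
  have orth: "(\<Sum>l\<in>K. c i l * cnj (c j l)) = (if i = j then 1 else 0)" if "i \<in> {1..N}" "j \<in> {1..N}" for i j
  proof -
    have "l2_inner (\<psi> i) (\<psi> j) = (\<Sum>l\<in>K. c i l * cnj (c j l))"
      unfolding c_def using supp that by (intro l2_inner_fourier K) (auto simp: c_def)
    then show ?thesis using \<psi> that by (simp add: eigenbasis_def)
  qed
  have diff: "(LINT x|torus. a x * of_real ((cmod (l2_rep (\<psi> j) x))\<^sup>2)) - (LINT x|torus. a x) = (\<Sum>m\<in>M. b m * B j m)"
    if j: "j \<in> {1..N}" for j
  proof -
    have "(LINT x|torus. a x * of_real ((cmod (l2_rep (\<psi> j) x))\<^sup>2)) = (\<Sum>k\<in>K. \<Sum>l\<in>K. c j k * cnj (c j l) * b (l - k))"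
      unfolding complex_norm_square c_def b_def
      using supp[OF j] by (intro integral_rep_mult_cnj_rep K torus_smooth_continuous a) (auto simp: c_def)
    \<comment> \<open>By normalisation of the eigenfunction the mean of \<open>a\<close> is exactly
      the diagonal term of the quadratic form.\<close>
    moreover have "(LINT x|torus. a x) = b 0 * (\<Sum>k\<in>K. c j k * cnj (c j k))"
      using orth[OF j j] by (simp add: b_def fourier_coeff_def)
    moreover have "c j k \<noteq> 0 \<Longrightarrow> c j l \<noteq> 0 \<Longrightarrow> P k l" for k l
      unfolding c_def P_def by (rule eigenbasis_fourier(2)[OF \<psi> h j])
    ultimately show ?thesis
      unfolding M_def B_def S_def using quadratic_form_by_difference[OF K, of "c j" P b] by simp
  qed
  have Bsum: "(\<Sum>j=1..N. (cmod (B j m))\<^sup>2) \<le> T * (norm (lattice_vec m))\<^sup>2" if m: "m \<in> M" for m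
  proof -
    have "(\<Sum>j=1..N. (cmod (B j m))\<^sup>2) \<le> real (card (S m))"
      unfolding B_def by (rule sum_shifted_correlation_le_card[OF _ K orth]) (auto simp: S_def)
    also have "S m \<subseteq> shell_slice (\<alpha> / (2 * pi)) (1 / (2 * pi * h)) m"
      by (auto simp: S_def P_def K_def shell_slice_def)
    then have "card (S m) \<le> card (shell_slice (\<alpha> / (2 * pi)) (1 / (2 * pi * h)) m)"
      by (intro card_mono finite_subset[OF _ K]) (auto simp: shell_slice_def K_def)
    also have "real \<dots> \<le> T * (norm (lattice_vec m))\<^sup>2" using M m by (intro T) auto
    finally show ?thesis by simp
  qed
  have A0: "(\<Sum>m\<in>M. cmod (b m)) \<le> A"
  proof -
    have "(\<Sum>m\<in>M. cmod (b m)) \<le> (\<Sum>m\<in>M. cmod (b m) * (norm (lattice_vec m))\<^sup>2)"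
    proof (rule sum_mono)
      fix m assume "m \<in> M"
      then have "1 \<le> (norm (lattice_vec m))\<^sup>2" using M one_le_norm_lattice_vec[of m] by (metis one_le_power)
      then show "cmod (b m) \<le> cmod (b m) * (norm (lattice_vec m))\<^sup>2" 
        by (metis mult.right_neutral mult_left_mono norm_ge_zero)
    qed
    then show ?thesis using A[OF M] by (simp add: b_def)
  qed
  define X where "X = (\<Sum>m\<in>M. cmod (b m) * (\<Sum>j=1..N. (cmod (B j m))\<^sup>2))"
  have "X \<ge> 0" unfolding X_def by (intro sum_nonneg mult_nonneg_nonneg) auto
  have "X \<le> (\<Sum>m\<in>M. cmod (b m) * (T * (norm (lattice_vec m))\<^sup>2))"
    unfolding X_def by (intro sum_mono mult_left_mono Bsum) auto
  also have "\<dots> = T * (\<Sum>m\<in>M. cmod (b m) * (norm (lattice_vec m))\<^sup>2)" by (simp add: sum_distrib_left mult_ac)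
  also have "\<dots> \<le> T * A" using A[OF M] T(1) by (intro mult_left_mono) (auto simp: b_def)
  finally have X: "X \<le> T * A" .
  have "(\<Sum>j=1..N. (cmod ((LINT x|torus. a x * of_real ((cmod (l2_rep (\<psi> j) x))\<^sup>2)) - (LINT x|torus. a x)))\<^sup>2)
      = (\<Sum>j=1..N. (cmod (\<Sum>m\<in>M. b m * B j m))\<^sup>2)"
    by (intro sum.cong refl) (simp only: diff)
  also have "\<dots> \<le> (\<Sum>j=1..N. (\<Sum>m\<in>M. cmod (b m)) * (\<Sum>m\<in>M. cmod (b m) * (cmod (B j m))\<^sup>2))"
    by (intro sum_mono cmod_sum_mult_squared_le)
  also have "\<dots> = (\<Sum>m\<in>M. cmod (b m)) * (\<Sum>j=1..N. \<Sum>m\<in>M. cmod (b m) * (cmod (B j m))\<^sup>2)"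
    by (rule sum_distrib_left[symmetric])
  also have "(\<Sum>j=1..N. \<Sum>m\<in>M. cmod (b m) * (cmod (B j m))\<^sup>2) = X"
    unfolding X_def by (subst sum.swap) (simp add: sum_distrib_left)
  \<comment> \<open>The empty set in the hypothesis on \<open>A\<close> yields
    \<open>A \<ge> 0\<close>.\<close>
  also have "(\<Sum>m\<in>M. cmod (b m)) * X \<le> A * (T * A)"
    using A0 X \<open>X \<ge> 0\<close> A[of "{}"] by (intro mult_mono) auto
  also have "\<dots> = A * A * T" by simp
  finally show ?thesis .
qed

theorem theorem1p2:
  fixes \<alpha> :: real and a :: "real ^ 'n::finite \<Rightarrow> complex"
  assumes "CARD('n) \<ge> 2" and "\<alpha> > 0" and "torus_smooth a"
  shows "\<exists>C>0. \<forall>h::real. 0 < h \<and> h \<le> 1 \<longrightarrow>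
    (let N = l2.dim (spectral_space \<alpha> h :: 'n l2 set) in
      N \<ge> 1 \<longrightarrow>
      (\<forall>\<psi> :: nat \<Rightarrow> 'n l2. eigenbasis \<alpha> h N \<psi> \<longrightarrow>
        1 / real N *
          (\<Sum>j=1..N. (cmod ((LINT x|torus. a x * of_real ((cmod (l2_rep (\<psi> j) x))\<^sup>2))
                           - (LINT x|torus. a x)))\<^sup>2)
        \<le> C * h powr (2 / 3)))"
proof -
  define c where "c = \<alpha> / (2 * pi)"
  have c: "c > 0" using assms(2) by (simp add: c_def)
  have "1 / (2 * pi) > 0" by simp
  from card_shell_slice_le_card_shell[OF c this assms(1)]
  obtain C1 where C1: "C1 > 0" "\<And>R N (m :: int ^ 'n). R \<ge> 1 / (2 * pi) \<Longrightarrow> N \<ge> 1 \<Longrightarrow>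
      real (card (shell c R :: (int ^ 'n) set)) \<le> N \<Longrightarrow> m \<noteq> 0 \<Longrightarrow>
      real (card (shell_slice c R m)) \<le> C1 * (norm (lattice_vec m))\<^sup>2 * (N / R)" by metis
  obtain A where A: "A > 0" "\<And>F. finite F \<Longrightarrow> 0 \<notin> F \<Longrightarrow>
      (\<Sum>m\<in>F. cmod (fourier_coeff a m) * (norm (lattice_vec m))\<^sup>2) \<le> A"
    using fourier_coeff_weighted_sum_bounded[OF assms(3)] by blast
  define C where "C = A * A * (C1 * (2 * pi))"
  have "C > 0" using A(1) C1(1) by (simp add: C_def)
  moreover have "1 / real N * (\<Sum>j=1..N. (cmod ((LINT x|torus. a x * of_real ((cmod (l2_rep (\<psi> j) x))\<^sup>2)) - (LINT x|torus. a x)))\<^sup>2)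
      \<le> C * h powr (2 / 3)"
    if h: "0 < h" "h \<le> 1" and N: "N \<ge> 1" and \<psi>: "eigenbasis \<alpha> h N \<psi>" for h N and \<psi> :: "nat \<Rightarrow> 'n l2"
  proof -
    define R where "R = 1 / (2 * pi * h)"
    \<comment> \<open>The condition \<open>h \<le> 1\<close> is what keeps the radius above the
      fixed lower bound for which \<open>C1\<close> was chosen.\<close>
    have R: "R \<ge> 1 / (2 * pi)" unfolding R_def using h by (intro divide_left_mono) auto
    have NR: "real N / R = 2 * pi * h * real N" by (simp add: R_def)
    have le: "real (card (shell c R :: (int ^ 'n) set)) \<le> real N"
      using card_shell_le_eigenbasis[OF \<psi> h(1) assms(2)] by (simp add: c_def R_def)
    \<comment> \<open>This is \<open>C1 * (N / R)\<close>: its factor \<open>N\<close> cancels in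
      the average and its factor \<open>h\<close> is the final rate.\<close>
    define T where "T = C1 * (2 * pi) * h * real N"
    have "real (card (shell_slice c R m)) \<le> T * (norm (lattice_vec m))\<^sup>2" if "m \<noteq> 0" for m :: "int ^ 'n"
      using C1(2)[OF R _ le that] N by (simp add: NR T_def mult_ac)
    then have "(\<Sum>j=1..N. (cmod ((LINT x|torus. a x * of_real ((cmod (l2_rep (\<psi> j) x))\<^sup>2)) - (LINT x|torus. a x)))\<^sup>2) \<le> A * A * T"
      using C1(1) h by (intro eigenbasis_variance_le[OF \<psi> h(1) assms(2,3) A(2)]) (auto simp: T_def c_def R_def)
    also have "\<dots> = real N * (C * h)" by (simp add: T_def C_def mult_ac)
    finally have "1 / real N * (\<Sum>j=1..N. (cmod ((LINT x|torus. a x * of_real ((cmod (l2_rep (\<psi> j) x))\<^sup>2)) - (LINT x|torus. a x)))\<^sup>2) \<le> C * h"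
      using N by (simp add: field_simps)
    also have "h = h powr 1" using h by simp
    also have "h powr 1 \<le> h powr (2 / 3)" using h by (intro powr_mono') auto
    then have "C * h powr 1 \<le> C * h powr (2 / 3)" using \<open>C > 0\<close> by (intro mult_left_mono) auto
    finally show ?thesis .
  qed
  ultimately show ?thesis by (auto simp: Let_def intro!: exI[of _ C])
qed

end
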